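(* Let $X$ be a compact metric space, $r:X\to X$ a finite-to-one, onto, Borel measurable map, $\mu$ a strongly invariant Borel probability measure on $X$ such that $r$ is ergodic with respect to $\mu$, and $m_0$ a quadrature mirror filter on $X$ such that $|m_0|$ is not $\mu$-a.e. equal to the constant $1$, $\mu(\{x: m_0(x)=0\})=0$, and $\log|m_0|^2\in L^1(X,\mu)$. Then there exists a fundamental domain $\mathcal{F}\subseteq X_\infty$ for $r_\infty$, and the wavelet representation $(L^2(X_\infty,\mu_\infty),U,\pi)$ has the direct integral decomposition $$[L^2(\mu_\infty),U,\pi]=\int_{\mathcal{F}}^\oplus[\mathcal{H}_z,U_z,\pi_z]\,d\mu_\infty(z),$$ i.e. there is a unitary operator $\Psi:L^2(X_\infty,\mu_\infty)\to\int_{\mathcal F}^\oplus\mathcal H_z\,d\mu_\infty(z)$ intertwining $U$ with $\int^\oplus U_z$ and $\pi(f)$ with $\int^\oplus\pi_z(f)$ for all $f\in L^\infty(X)$; moreover the component representations $[\mathcal{H}_z,U_z,\pi_z]$ are irreducible for $\mu_\infty$-a.e. $z\in\mathcal{F}$.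
   Context: Strong invariance of $\mu$ means $\int f\,d\mu=\int\frac{1}{\#r^{-1}(x)}\sum_{r(y)=x}f(y)\,d\mu(x)$ for every bounded Borel $f$. A quadrature mirror filter is a Borel $m_0:X\to\mathbb{C}$ with $\frac{1}{\#r^{-1}(x)}\sum_{r(y)=x}|m_0(y)|^2=1$ for all $x$. Put $W(x)=|m_0(x)|^2/\#r^{-1}(r(x))$. Solenoid: $X_\infty=\{(x_0,x_1,\dots)\in X^{\mathbb N}: r(x_{n+1})=x_n\ \forall n\ge0\}$ with the cylinder $\sigma$-algebra; $r_\infty(x_0,x_1,\dots)=(r(x_0),x_0,x_1,\dots)$ (a measurable automorphism with inverse the left shift); $\theta_0(x_0,x_1,\dots)=x_0$. For $x\in X$, $\Omega_x=\{(x_n)\in X_\infty:x_0=x\}$ carries the probability measure $P_x$ with $P_x(x_1=z_1,\dots,x_n=z_n)=W(z_1)\cdots W(z_n)$; $\mu_\infty$ is defined by $\int f\,d\mu_\infty=\int_X\int_{\Omega_x}f\,dP_x\,d\mu(x)$. The wavelet representation is realized on $L^2(X_\infty,\mu_\infty)$ by $U\xi=(m_0\circ\theta_0)\,\xi\circ r_\infty$ and $\pi(f)\xi=(f\circ\theta_0)\xi$ for $f\in L^\infty(X)$. A fundamental domain is a measurable $\mathcal F\subseteq X_\infty$ with, up to $\mu_\infty$-null sets, $\bigcup_{n\in\mathbb Z}r_\infty^n(\mathcal F)=X_\infty$ and $r_\infty^n(\mathcal F)\cap r_\infty^m(\mathcal F)=\emptyset$ for $n\ne m$. Define $\tilde m_0=1$,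 $\tilde m_n=\prod_{k=0}^{n-1}m_0\circ\theta_0\circ r_\infty^k$ for $n\ge1$, $\tilde m_n=1/\prod_{k=n}^{-1}m_0\circ\theta_0\circ r_\infty^{k}$ for $n<0$. For $z\in X_\infty$ with all $\tilde m_n(z)\neq0$ (a $\mu_\infty$-conull set), $\mathcal H_z=\{(\xi_n)_{n\in\mathbb Z}:\sum_n|\xi_n|^2|\tilde m_n(z)|^2<\infty\}$ with $\langle\xi,\eta\rangle=\sum_n\xi_n\overline{\eta_n}|\tilde m_n(z)|^2$; $U_z(\xi_n)_n=(m_0(\theta_0(r_\infty^n z))\,\xi_{n+1})_n$; $\pi_z(f)(\xi_n)_n=(f(\theta_0(r_\infty^nz))\,\xi_n)_n$ for bounded Borel $f$ on $X$. *)

theory Defs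
  imports "HOL-Probability.Probability"
begin

definition strongly_invariant :: "('a::metric_space \<Rightarrow> 'a) \<Rightarrow> 'a measure \<Rightarrow> bool" where
  "strongly_invariant r \<mu> \<longleftrightarrow>
     (\<forall>f::'a \<Rightarrow> real. f \<in> borel_measurable borel \<longrightarrow> bounded (range f) \<longrightarrow>
        (\<integral>x. f x \<partial>\<mu>) = (\<integral>x. (1 / real (card (r -` {x}))) * (\<Sum>y\<in>r -` {x}. f y) \<partial>\<mu>))"

definition ergodic :: "('a::metric_space \<Rightarrow> 'a) \<Rightarrow> 'a measure \<Rightarrow> bool" where
  "ergodic r \<mu> \<longleftrightarrow>
     (\<forall>A \<in> sets borel. r -` A = A \<longrightarrow> emeasure \<mu> A = 0 \<or> emeasure \<mu> A = 1)"

definition qmf :: "('a::metric_space \<Rightarrow> 'a) \<Rightarrow> ('a \<Rightarrow> complex) \<Rightarrow> bool" where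
  "qmf r m0 \<longleftrightarrow> m0 \<in> borel_measurable borel \<and>
     (\<forall>x. (1 / real (card (r -` {x}))) * (\<Sum>y\<in>r -` {x}. (cmod (m0 y))\<^sup>2) = 1)"

definition W :: "('a \<Rightarrow> 'a) \<Rightarrow> ('a \<Rightarrow> complex) \<Rightarrow> 'a \<Rightarrow> real" where
  "W r m0 x = (cmod (m0 x))\<^sup>2 / real (card (r -` {r x}))"

definition sol :: "('a \<Rightarrow> 'a) \<Rightarrow> (nat \<Rightarrow> 'a) set" where
  "sol r = {x. \<forall>n. r (x (Suc n)) = x n}"

definition sol_space :: "('a::topological_space \<Rightarrow> 'a) \<Rightarrow> (nat \<Rightarrow> 'a) measure" where
  "sol_space r = restrict_space (Pi\<^sub>M UNIV (\<lambda>_. borel)) (sol r)"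

definition r_inf :: "('a \<Rightarrow> 'a) \<Rightarrow> (nat \<Rightarrow> 'a) \<Rightarrow> (nat \<Rightarrow> 'a)" where
  "r_inf r x = (\<lambda>n. if n = 0 then r (x 0) else x (n - 1))"

definition lshift :: "(nat \<Rightarrow> 'a) \<Rightarrow> (nat \<Rightarrow> 'a)" where
  "lshift x = (\<lambda>n. x (Suc n))"

text \<open>Integer powers of r_inf (its inverse is the left shift).\<close>
definition r_inf_pow :: "('a \<Rightarrow> 'a) \<Rightarrow> int \<Rightarrow> (nat \<Rightarrow> 'a) \<Rightarrow> (nat \<Rightarrow> 'a)" where
  "r_inf_pow r n = (if n \<ge> 0 then (r_inf r ^^ nat n) else (lshift ^^ nat (- n)))"

definition theta0 :: "(nat \<Rightarrow> 'a) \<Rightarrow> 'a" where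
  "theta0 x = x 0"

definition paths :: "('a \<Rightarrow> 'a) \<Rightarrow> 'a \<Rightarrow> nat \<Rightarrow> (nat \<Rightarrow> 'a) set" where
  "paths r x n = {p. p 0 = x \<and> (\<forall>k<n. r (p (Suc k)) = p k) \<and> (\<forall>k>n. p k = undefined)}"

text \<open>Characterisation of mu_inf: a measure on the solenoid whose values on cylinder sets are
  the mu-integral of P_x(x_0 in A_0, ..., x_n in A_n), where P_x(x_1=z_1,...,x_n=z_n) = W(z_1)...W(z_n).
  These values determine the measure uniquely (pi-system generating the cylinder sigma-algebra).\<close>
definition is_mu_inf :: "('a::metric_space \<Rightarrow> 'a) \<Rightarrow> 'a measure \<Rightarrow> ('a \<Rightarrow> complex) \<Rightarrow> (nat \<Rightarrow> 'a) measure \<Rightarrow> bool" where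
  "is_mu_inf r \<mu> m0 M \<longleftrightarrow>
     space M = sol r \<and> sets M = sets (sol_space r) \<and>
     (\<forall>n (A :: nat \<Rightarrow> 'a set). (\<forall>k. A k \<in> sets borel) \<longrightarrow>
        emeasure M {x \<in> sol r. \<forall>k\<le>n. x k \<in> A k} =
        (\<integral>\<^sup>+ x. (\<Sum>p\<in>paths r x n. ennreal (\<Prod>k\<in>{1..n}. W r m0 (p k)) *
                     indicator {q. \<forall>k\<le>n. q k \<in> A k} p) \<partial>\<mu>))"

definition mu_inf :: "('a::metric_space \<Rightarrow> 'a) \<Rightarrow> 'a measure \<Rightarrow> ('a \<Rightarrow> complex) \<Rightarrow> (nat \<Rightarrow> 'a) measure" where
  "mu_inf r \<mu> m0 = (SOME M. is_mu_inf r \<mu> m0 M)"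

definition L2 :: "'b measure \<Rightarrow> ('b \<Rightarrow> complex) set" where
  "L2 M = {\<xi> \<in> borel_measurable M. (\<integral>\<^sup>+ z. ennreal ((cmod (\<xi> z))\<^sup>2) \<partial>M) < \<infinity>}"

definition U_op :: "('a \<Rightarrow> 'a) \<Rightarrow> ('a \<Rightarrow> complex) \<Rightarrow> ((nat \<Rightarrow> 'a) \<Rightarrow> complex) \<Rightarrow> ((nat \<Rightarrow> 'a) \<Rightarrow> complex)" where
  "U_op r m0 \<xi> = (\<lambda>z. m0 (theta0 z) * \<xi> (r_inf r z))"

definition pi_op :: "('a \<Rightarrow> complex) \<Rightarrow> ((nat \<Rightarrow> 'a) \<Rightarrow> complex) \<Rightarrow> ((nat \<Rightarrow> 'a) \<Rightarrow> complex)" where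
  "pi_op f \<xi> = (\<lambda>z. f (theta0 z) * \<xi> z)"

definition fundamental_domain :: "('a \<Rightarrow> 'a) \<Rightarrow> (nat \<Rightarrow> 'a) measure \<Rightarrow> (nat \<Rightarrow> 'a) set \<Rightarrow> bool" where
  "fundamental_domain r M F \<longleftrightarrow> F \<in> sets M \<and>
     (AE z in M. z \<in> (\<Union>n::int. r_inf_pow r n ` F)) \<and>
     (\<forall>n m::int. n \<noteq> m \<longrightarrow> (AE z in M. z \<notin> r_inf_pow r n ` F \<inter> r_inf_pow r m ` F))"

definition mtilde :: "('a \<Rightarrow> 'a) \<Rightarrow> ('a \<Rightarrow> complex) \<Rightarrow> int \<Rightarrow> (nat \<Rightarrow> 'a) \<Rightarrow> complex" where
  "mtilde r m0 n z =
     (if n \<ge> 0 then (\<Prod>k\<in>{0..<n}. m0 (theta0 (r_inf_pow r k z)))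
      else 1 / (\<Prod>k\<in>{n..-1}. m0 (theta0 (r_inf_pow r k z))))"

definition wnorm2 :: "('a \<Rightarrow> 'a) \<Rightarrow> ('a \<Rightarrow> complex) \<Rightarrow> (nat \<Rightarrow> 'a) \<Rightarrow> (int \<Rightarrow> complex) \<Rightarrow> ennreal" where
  "wnorm2 r m0 z \<xi> =
     (\<integral>\<^sup>+ n. ennreal ((cmod (\<xi> n))\<^sup>2 * (cmod (mtilde r m0 n z))\<^sup>2) \<partial>count_space UNIV)"

definition H_z :: "('a \<Rightarrow> 'a) \<Rightarrow> ('a \<Rightarrow> complex) \<Rightarrow> (nat \<Rightarrow> 'a) \<Rightarrow> (int \<Rightarrow> complex) set" where
  "H_z r m0 z = {\<xi>. wnorm2 r m0 z \<xi> < \<infinity>}"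

definition U_z :: "('a \<Rightarrow> 'a) \<Rightarrow> ('a \<Rightarrow> complex) \<Rightarrow> (nat \<Rightarrow> 'a) \<Rightarrow> (int \<Rightarrow> complex) \<Rightarrow> (int \<Rightarrow> complex)" where
  "U_z r m0 z \<xi> = (\<lambda>n. m0 (theta0 (r_inf_pow r n z)) * \<xi> (n + 1))"

definition pi_z :: "('a \<Rightarrow> 'a) \<Rightarrow> (nat \<Rightarrow> 'a) \<Rightarrow> ('a \<Rightarrow> complex) \<Rightarrow> (int \<Rightarrow> complex) \<Rightarrow> (int \<Rightarrow> complex)" where
  "pi_z r z f \<xi> = (\<lambda>n. f (theta0 (r_inf_pow r n z)) * \<xi> n)"

definition closed_subspace_z :: "('a \<Rightarrow> 'a) \<Rightarrow> ('a \<Rightarrow> complex) \<Rightarrow> (nat \<Rightarrow> 'a) \<Rightarrow> (int \<Rightarrow> complex) set \<Rightarrow> bool" where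
  "closed_subspace_z r m0 z K \<longleftrightarrow> K \<subseteq> H_z r m0 z \<and> (\<lambda>_. 0) \<in> K \<and>
     (\<forall>\<xi>\<in>K. \<forall>\<eta>\<in>K. \<forall>a b::complex. (\<lambda>n. a * \<xi> n + b * \<eta> n) \<in> K) \<and>
     (\<forall>s \<xi>. (\<forall>k. s k \<in> K) \<longrightarrow> \<xi> \<in> H_z r m0 z \<longrightarrow>
        ((\<lambda>k. wnorm2 r m0 z (\<lambda>n. s k n - \<xi> n)) \<longlonglongrightarrow> 0) \<longrightarrow> \<xi> \<in> K)"

text \<open>Irreducibility: the only closed subspaces reducing U_z (i.e. invariant under U_z and
  its inverse, equivalently U_z ` K = K) and invariant under every pi_z(f), f bounded Borel,
  are 0 and H_z.\<close>
definition irreducible_z :: "('a::metric_space \<Rightarrow> 'a) \<Rightarrow> ('a \<Rightarrow> complex) \<Rightarrow> (nat \<Rightarrow> 'a) \<Rightarrow> bool" where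
  "irreducible_z r m0 z \<longleftrightarrow>
     (\<forall>K. closed_subspace_z r m0 z K \<longrightarrow> U_z r m0 z ` K = K \<longrightarrow>
        (\<forall>f::'a \<Rightarrow> complex. f \<in> borel_measurable borel \<longrightarrow> bounded (range f) \<longrightarrow> pi_z r z f ` K \<subseteq> K) \<longrightarrow>
        K = {\<lambda>_. 0} \<or> K = H_z r m0 z)"

text \<open>Elements: measurable fields z |-> s z in H_z with finite square-integral over F
  (identified when equal mu_inf-a.e. on F).\<close>
definition direct_integral :: "('a \<Rightarrow> 'a) \<Rightarrow> ('a \<Rightarrow> complex) \<Rightarrow> (nat \<Rightarrow> 'a) measure \<Rightarrow> (nat \<Rightarrow> 'a) set
    \<Rightarrow> ((nat \<Rightarrow> 'a) \<Rightarrow> int \<Rightarrow> complex) set" where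
  "direct_integral r m0 M F =
     {s. (\<forall>n. (\<lambda>z. s z n) \<in> borel_measurable M) \<and>
         (\<integral>\<^sup>+ z. indicator F z * wnorm2 r m0 z (s z) \<partial>M) < \<infinity>}"

definition unitary_intertwiner :: "('a::metric_space \<Rightarrow> 'a) \<Rightarrow> ('a \<Rightarrow> complex) \<Rightarrow> (nat \<Rightarrow> 'a) measure \<Rightarrow> (nat \<Rightarrow> 'a) set
    \<Rightarrow> (((nat \<Rightarrow> 'a) \<Rightarrow> complex) \<Rightarrow> ((nat \<Rightarrow> 'a) \<Rightarrow> int \<Rightarrow> complex)) \<Rightarrow> bool" where
  "unitary_intertwiner r m0 M F \<Psi> \<longleftrightarrow>
     (\<forall>\<xi>\<in>L2 M. \<Psi> \<xi> \<in> direct_integral r m0 M F) \<and>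
     (\<forall>\<xi>\<in>L2 M. \<forall>\<eta>\<in>L2 M. \<forall>a b::complex.
        AE z in M. z \<in> F \<longrightarrow> (\<forall>n. \<Psi> (\<lambda>w. a * \<xi> w + b * \<eta> w) z n = a * \<Psi> \<xi> z n + b * \<Psi> \<eta> z n)) \<and>
     (\<forall>\<xi>\<in>L2 M. (\<integral>\<^sup>+ z. indicator F z * wnorm2 r m0 z (\<Psi> \<xi> z) \<partial>M) =
                 (\<integral>\<^sup>+ z. ennreal ((cmod (\<xi> z))\<^sup>2) \<partial>M)) \<and>
     (\<forall>s\<in>direct_integral r m0 M F. \<exists>\<xi>\<in>L2 M. AE z in M. z \<in> F \<longrightarrow> (\<forall>n. \<Psi> \<xi> z n = s z n)) \<and>
     (\<forall>\<xi>\<in>L2 M. AE z in M. z \<in> F \<longrightarrow>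
        (\<forall>n. \<Psi> (U_op r m0 \<xi>) z n = U_z r m0 z (\<Psi> \<xi> z) n)) \<and>
     (\<forall>f::'a \<Rightarrow> complex. f \<in> borel_measurable borel \<longrightarrow> bounded (range f) \<longrightarrow>
        (\<forall>\<xi>\<in>L2 M. AE z in M. z \<in> F \<longrightarrow>
           (\<forall>n. \<Psi> (pi_op f \<xi>) z n = pi_z r z f (\<Psi> \<xi> z) n)))"

end

theory Submission
  imports Defs "HOL-Real_Asymp.Real_Asymp"
begin

text \<open>The measure \<open>\<mu>\<^sub>\<infinity>\<close> is quasi-invariant under \<open>r_inf\<close>: pulling back along \<open>r_inf\<^sup>n\<close> has density
  \<open>\<bar>mtilde n\<bar>\<^sup>2\<close>. Strict concavity of the logarithm gives \<open>\<integral>ln \<bar>m0\<bar>\<^sup>2 d\<mu> < 0\<close>, so by the maximal ergodic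
  lemma these densities tend to 0 along almost every forward orbit. Hence almost every orbit has
  points whose density exceeds all later ones, and a finite measure cannot support orbits on which
  such points recur indefinitely to the left; the leftmost one of each orbit gives a fundamental
  domain. Sampling a function along the orbits of that domain is the unitary equivalence. Almost
  every orbit projects injectively to \<open>X\<close>, so the multiplication operators separate its points,
  and the shift connects them: the components are irreducible.\<close>

section \<open>Fibre averages and the maximal ergodic lemma\<close>

text \<open>Leftward recurrence is excluded by a conservation argument. Decay of the weights bounds
  the heavy times of an orbit on the right only; on the left one moves each recurrent peak to the
  preceding peak. This maps the recurrent set injectively into itself with Jacobian above 1, which a
  finite measure permits only on a null set. Two obstacles shape the beginning. \<open>X\<close> is
  merely a metric space, while the solenoid is cut out by equations between coordinates; its
  measurability is drawn from compactness, which yields countably many open sets separating points.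
  And \<open>mu_inf\<close> is a choice among the measures with prescribed cylinder values, so it is
  usable only after such a measure has been built: it is the law of the Markov chain that starts
  with \<mu> and moves from \<open>x\<close> to a preimage \<open>y\<close> with probability
  \<open>W y\<close>. The filter identity makes these probabilities add up to 1, and strong
  invariance turns the one-step duality of this chain into the density
  \<open>|m0|^2\<close>.\<close>

locale finite_to_one_system = prob_space \<mu> for \<mu> :: "'a::metric_space measure" +
  fixes r :: "'a \<Rightarrow> 'a"
  assumes compact_UNIV: "compact (UNIV :: 'a set)"
    and surj_r: "surj r"
    and finite_fibre: "finite (r -` {x})"
    and r_measurable [measurable]: "r \<in> borel_measurable borel"
    and sets_\<mu> [measurable_cong, simp]: "sets \<mu> = sets borel"
    and strongly_inv: "strongly_invariant r \<mu>"
begin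

lemma space_\<mu> [simp]: "space \<mu> = UNIV"
  using sets_eq_imp_space_eq[OF sets_\<mu>] by simp

lemma measurable_\<mu> [simp]: "borel_measurable \<mu> = borel_measurable borel"
  by (rule measurable_cong_sets) simp_all

lemma card_fibre_pos: "0 < card (r -` {x})"
  using surj_r finite_fibre[of x] by (auto simp: card_gt_0_iff surj_def) (metis vimage_singleton_eq empty_iff)

text \<open>Composed with \<open>r\<close> this is the conditional expectation given the
  sigma-algebra pulled back along \<open>r\<close>. Values in \<open>ennreal\<close> spare the later
  identities any integrability condition.\<close>

definition fibre_avg :: "('a \<Rightarrow> ennreal) \<Rightarrow> 'a \<Rightarrow> ennreal" where
  "fibre_avg f x = ennreal (1 / real (card (r -` {x}))) * (\<Sum>y\<in>r -` {x}. f y)"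

text \<open>Measurability of the fibre average needs no selection theorem: if the average of an
  indicator were not integrable, neither would be that of the complement, so by the convention
  that non-integrable functions have integral 0 strong invariance would give both sets measure 0.\<close>

lemma fibre_avg_indicator:
  assumes B [measurable]: "B \<in> sets borel"
  shows "fibre_avg (indicator B) \<in> borel_measurable borel"
    and "(\<integral>\<^sup>+x. fibre_avg (indicator B) x \<partial>\<mu>) = emeasure \<mu> B"
proof -
  define a :: "'a set \<Rightarrow> 'a \<Rightarrow> real" where
    "a C x = (1 / real (card (r -` {x}))) * (\<Sum>y\<in>r -` {x}. indicator C y)" for C x
  have inv: "measure \<mu> C = (\<integral>x. a C x \<partial>\<mu>)" if "C \<in> sets borel" for C
  proof -
    have "bounded (range (indicator C :: 'a \<Rightarrow> real))"
      by (rule boundedI[of _ 1]) (auto simp: indicator_def)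
    moreover have "(\<lambda>x. indicator C x :: real) \<in> borel_measurable borel"
      using that by measurable
    ultimately have "(\<integral>x. indicator C x \<partial>\<mu>) = (\<integral>x. a C x \<partial>\<mu>)"
      using strongly_inv that unfolding strongly_invariant_def a_def by blast
    then show ?thesis using that by simp
  qed
  have compl: "a (- C) x = 1 - a C x" for C x
  proof -
    have "(\<Sum>y\<in>r -` {x}. indicator (- C) y :: real) = (\<Sum>y\<in>r -` {x}. 1 - indicator C y)"
      by (intro sum.cong) (auto simp: indicator_def)
    then show ?thesis
      using card_fibre_pos[of x] by (simp add: a_def sum_subtractf field_simps)
  qed
  have int: "integrable \<mu> (a B)"
  proof (rule ccontr)
    assume n: "\<not> integrable \<mu> (a B)"
    have "\<not> integrable \<mu> (a (- B))"
    proof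
      assume "integrable \<mu> (a (- B))"
      then have "integrable \<mu> (\<lambda>x. 1 - a (- B) x)" by simp
      then show False using n by (simp add: compl)
    qed
    then have "measure \<mu> B = 0" "measure \<mu> (- B) = 0"
      using n inv[of B] inv[of "- B"] by (auto simp: not_integrable_integral_eq)
    moreover have "measure \<mu> (space \<mu> - B) = 1 - measure \<mu> B"
      by (rule prob_compl) simp
    ultimately show False by (simp add: Compl_eq_Diff_UNIV)
  qed
  have fibre_avg_a: "fibre_avg (indicator B) x = ennreal (a B x)" for x
  proof -
    have "(\<Sum>y\<in>r -` {x}. indicator B y :: ennreal) = ennreal (\<Sum>y\<in>r -` {x}. indicator B y)"
      by (subst sum_ennreal[symmetric]) (auto simp: ennreal_indicator)
    then show ?thesis
      unfolding fibre_avg_def a_def by (simp only: ennreal_mult' [symmetric] divide_nonneg_nonneg zero_le_one of_nat_0_le_iff)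
  qed
  have a_nonneg: "0 \<le> a B x" for x
    by (simp add: a_def sum_nonneg)
  have [measurable]: "a B \<in> borel_measurable borel"
    using borel_measurable_integrable[OF int] by simp
  show "fibre_avg (indicator B) \<in> borel_measurable borel"
    unfolding fibre_avg_a[abs_def] by measurable
  show "(\<integral>\<^sup>+x. fibre_avg (indicator B) x \<partial>\<mu>) = emeasure \<mu> B"
    unfolding fibre_avg_a using nn_integral_eq_integral[OF int] a_nonneg inv[OF B]
    by (simp add: emeasure_eq_measure)
qed

text \<open>Both claims go through one induction, because each integral identity needs the
  measurability of the average at the same stage. Strong invariance speaks of bounded integrands;
  the supremum step removes the bound.\<close>

lemma fibre_avg_props:
  assumes "f \<in> borel_measurable borel"
  shows "fibre_avg f \<in> borel_measurable borel \<and> (\<integral>\<^sup>+x. fibre_avg f x \<partial>\<mu>) = (\<integral>\<^sup>+x. f x \<partial>\<mu>)"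
  using assms
proof (induction rule: borel_measurable_induct)
  case (cong f g)
  then have "f = g" by auto
  with cong show ?case by simp
next
  case (set A)
  then show ?case using fibre_avg_indicator[of A] by simp
next
  case (mult u c)
  then have [measurable]: "fibre_avg u \<in> borel_measurable borel" by simp
  have "fibre_avg (\<lambda>x. c * u x) = (\<lambda>x. c * fibre_avg u x)"
    by (auto simp: fibre_avg_def sum_distrib_left[symmetric] mult_ac)
  with mult show ?case by (simp add: nn_integral_cmult)
next
  case (add u v)
  then have [measurable]: "fibre_avg u \<in> borel_measurable borel" "fibre_avg v \<in> borel_measurable borel" by simp_all
  have "fibre_avg (\<lambda>x. v x + u x) = (\<lambda>x. fibre_avg v x + fibre_avg u x)"
    by (auto simp: fibre_avg_def sum.distrib distrib_left)
  with add show ?case by (simp add: nn_integral_add)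
next
  case (seq U)
  then have [measurable]: "fibre_avg (U i) \<in> borel_measurable borel" for i by simp
  have U_meas [measurable]: "U i \<in> borel_measurable borel" for i using seq by simp
  have U_mono: "mono (\<lambda>i. U i y)" for y
    using seq.hyps by (auto simp: mono_def le_fun_def)
  have eq: "fibre_avg (SUP i. U i) x = (SUP i. fibre_avg (U i) x)" for x
  proof -
    have "(\<Sum>y\<in>r -` {x}. (SUP i. U i) y) = (SUP i. \<Sum>y\<in>r -` {x}. U i y)"
      by (subst ennreal_SUP_sum) (auto simp: image_comp U_mono incseq_def monoD)
    then show ?thesis
      by (simp add: fibre_avg_def SUP_mult_left_ennreal)
  qed
  have inc: "incseq (\<lambda>i. fibre_avg (U i))"
    using U_mono by (auto simp: mono_def le_fun_def fibre_avg_def intro!: mult_left_mono sum_mono)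
  have "(\<integral>\<^sup>+x. fibre_avg (SUP i. U i) x \<partial>\<mu>) = (SUP i. \<integral>\<^sup>+x. fibre_avg (U i) x \<partial>\<mu>)"
    unfolding eq by (rule nn_integral_monotone_convergence_SUP[OF inc]) simp
  also have "\<dots> = (SUP i. \<integral>\<^sup>+x. U i x \<partial>\<mu>)"
    using seq by simp
  also have "\<dots> = (\<integral>\<^sup>+x. (SUP i. U i x) \<partial>\<mu>)"
    by (rule nn_integral_monotone_convergence_SUP[symmetric]) (use seq in simp_all)
  finally show ?case
    unfolding eq[abs_def] by (simp add: image_comp)
qed

lemma fibre_avg_measurable [measurable]: "f \<in> borel_measurable borel \<Longrightarrow> fibre_avg f \<in> borel_measurable borel"
  and nn_integral_fibre_avg: "f \<in> borel_measurable borel \<Longrightarrow> (\<integral>\<^sup>+x. fibre_avg f x \<partial>\<mu>) = (\<integral>\<^sup>+x. f x \<partial>\<mu>)"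
  using fibre_avg_props by auto

text \<open>The pull-out rule of conditional expectations: \<open>g (r y)\<close> is constant on a
  fibre.\<close>

lemma fibre_avg_mult_comp: "fibre_avg (\<lambda>y. f y * g (r y)) x = fibre_avg f x * g x"
proof -
  have "(\<Sum>y\<in>r -` {x}. f y * g (r y)) = (\<Sum>y\<in>r -` {x}. f y) * g x"
    by (subst sum_distrib_right) (auto intro!: sum.cong)
  then show ?thesis by (simp add: fibre_avg_def mult.assoc)
qed

lemma fibre_avg_const: "fibre_avg (\<lambda>_. c) x = c"
proof -
  have "fibre_avg (\<lambda>_. c) x = (ennreal (1 / real (card (r -` {x}))) * ennreal (real (card (r -` {x})))) * c"
    by (simp add: fibre_avg_def mult.assoc ennreal_of_nat_eq_real_of_nat)
  also have "ennreal (1 / real (card (r -` {x}))) * ennreal (real (card (r -` {x}))) = 1"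
    using card_fibre_pos[of x] by (subst ennreal_mult[symmetric]) auto
  finally show ?thesis by simp
qed

text \<open>Strong invariance contains ordinary invariance, since averaging \<open>g (r y)\<close>
  over the fibre of \<open>x\<close> returns \<open>g x\<close>.\<close>

lemma nn_integral_invariant:
  assumes [measurable]: "g \<in> borel_measurable borel"
  shows "(\<integral>\<^sup>+x. g (r x) \<partial>\<mu>) = (\<integral>\<^sup>+x. g x \<partial>\<mu>)"
proof -
  have "(\<integral>\<^sup>+x. g (r x) \<partial>\<mu>) = (\<integral>\<^sup>+x. fibre_avg (\<lambda>y. g (r y)) x \<partial>\<mu>)"
    by (rule nn_integral_fibre_avg[symmetric]) measurable
  also have "\<dots> = (\<integral>\<^sup>+x. g x \<partial>\<mu>)"
    using fibre_avg_mult_comp[of "\<lambda>_. 1" g] by (simp add: fibre_avg_const)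
  finally show ?thesis .
qed

lemma distr_r: "distr \<mu> \<mu> r = \<mu>"
proof (rule measure_eqI)
  fix A assume "A \<in> sets (distr \<mu> \<mu> r)"
  then have [measurable]: "A \<in> sets borel" by simp
  have "emeasure (distr \<mu> \<mu> r) A = (\<integral>\<^sup>+x. indicator A (r x) \<partial>\<mu>)"
    by (subst nn_integral_indicator[symmetric], simp, subst nn_integral_distr) auto
  also have "\<dots> = emeasure \<mu> A"
    by (subst nn_integral_invariant) auto
  finally show "emeasure (distr \<mu> \<mu> r) A = emeasure \<mu> A" .
qed simp

lemma AE_comp_r:
  assumes "AE x in \<mu>. P x" shows "AE x in \<mu>. P (r x)"
proof -
  have "AE x in distr \<mu> \<mu> r. P x" unfolding distr_r by (rule assms)
  then show ?thesis by (rule AE_distrD[rotated]) simp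
qed

lemma AE_comp_r_funpow:
  assumes "AE x in \<mu>. P x" shows "AE x in \<mu>. \<forall>n. P ((r ^^ n) x)"
proof -
  have "AE x in \<mu>. P ((r ^^ n) x)" for n
  proof (induction n)
    case (Suc n) then show ?case using AE_comp_r[OF Suc] by (simp add: funpow_swap1)
  qed (use assms in simp)
  then show ?thesis by (simp add: AE_all_countable)
qed

lemma integral_comp_r:
  fixes g :: "'a \<Rightarrow> real"
  assumes "integrable \<mu> g"
  shows "integrable \<mu> (\<lambda>x. g (r x))" and "(\<integral>x. g (r x) \<partial>\<mu>) = (\<integral>x. g x \<partial>\<mu>)"
proof -
  have [measurable]: "g \<in> borel_measurable borel"
    using borel_measurable_integrable[OF assms] by simp
  show "integrable \<mu> (\<lambda>x. g (r x))"
    using assms by (subst integrable_distr_eq[where N=\<mu>, symmetric]) (simp_all add: distr_r)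
  show "(\<integral>x. g (r x) \<partial>\<mu>) = (\<integral>x. g x \<partial>\<mu>)"
    by (subst integral_distr[where N=\<mu>, symmetric]) (simp_all add: distr_r)
qed

section \<open>Maxima of Birkhoff sums and the maximal ergodic lemma\<close>

lemma funpow_measurable [measurable]: "(r ^^ n) \<in> borel_measurable borel"
proof (induction n)
  case (Suc n)
  then show ?case by (simp add: measurable_comp[OF _ r_measurable])
qed (simp add: id_def)

text \<open>The largest of the Birkhoff sums of lengths 0 to \<open>n\<close> along
  \<open>x\<close>. Peeling off the first summand, as the recursion does, exposes the term at
  \<open>r x\<close> that invariance can cancel.\<close>

definition max_sum :: "('a \<Rightarrow> real) \<Rightarrow> nat \<Rightarrow> 'a \<Rightarrow> real" where
  "max_sum g n = ((\<lambda>h x. max 0 (g x + h (r x))) ^^ n) (\<lambda>_. 0)"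

lemma max_sum_0 [simp]: "max_sum g 0 = (\<lambda>_. 0)"
  and max_sum_Suc [simp]: "max_sum g (Suc n) = (\<lambda>x. max 0 (g x + max_sum g n (r x)))"
  by (simp_all add: max_sum_def)

lemma max_sum_nonneg: "0 \<le> max_sum g n x"
  by (cases n) auto

lemma max_sum_le_Suc: "max_sum g n x \<le> max_sum g (Suc n) x"
proof (induction n arbitrary: x)
  case (Suc n)
  show ?case using Suc[of "r x"] by simp
qed simp

lemma max_sum_mono: "mono (\<lambda>n. max_sum g n x)"
  using max_sum_le_Suc by (rule incseq_SucI)

lemma sum_le_max_sum: "(\<Sum>k<n. g ((r ^^ k) x)) \<le> max_sum g n x"
proof (induction n arbitrary: x)
  case (Suc n)
  have "(\<Sum>k<Suc n. g ((r ^^ k) x)) = g x + (\<Sum>k<n. g ((r ^^ k) (r x)))"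
    by (subst sum.lessThan_Suc_shift) (simp add: funpow_swap1)
  also have "\<dots> \<le> g x + max_sum g n (r x)" using Suc[of "r x"] by simp
  finally show ?case by simp
qed simp

lemma max_sum_measurable [measurable]:
  "g \<in> borel_measurable borel \<Longrightarrow> max_sum g n \<in> borel_measurable borel"
  by (induction n) auto

lemma integrable_max_sum:
  assumes "integrable \<mu> g" shows "integrable \<mu> (max_sum g n)"
proof (induction n)
  case (Suc n)
  then show ?case using assms integral_comp_r(1)[OF Suc] by simp
qed simp

text \<open>Garsia's argument: by invariance a difference \<open>h x - h (r x)\<close> integrates to
  0, so \<open>g\<close> has nonnegative integral over the set where \<open>max_sum g n\<close> is
  positive, and these sets increase to almost everything.\<close>

lemma maximal_ergodic:
  assumes g: "integrable \<mu> g" and pos: "AE x in \<mu>. \<exists>n. 0 < max_sum g n x"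
  shows "0 \<le> (\<integral>x. g x \<partial>\<mu>)"
proof -
  have [measurable]: "g \<in> borel_measurable borel"
    using borel_measurable_integrable[OF g] by simp
  define I :: "nat \<Rightarrow> 'a \<Rightarrow> real" where "I n x = (if 0 < max_sum g n x then g x else 0)" for n x
  have [measurable]: "I n \<in> borel_measurable borel" for n
    unfolding I_def[abs_def] by measurable
  have I_int: "integrable \<mu> (I n)" for n
    by (rule Bochner_Integration.integrable_bound[OF g]) (auto simp: I_def)
  have I_nonneg: "0 \<le> (\<integral>x. I n x \<partial>\<mu>)" for n
  proof (cases n)
    case 0
    then show ?thesis by (simp add: I_def)
  next
    case (Suc k)
    \<comment> \<open>A positive maximum equals \<open>g x + max_sum g k (r x)\<close>, and going
      from \<open>k\<close> to \<open>n\<close> only enlarges the last term. Where the maximum is 0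
      the left side is at most 0.\<close>
    have "max_sum g n x - max_sum g n (r x) \<le> I n x" for x
      using max_sum_le_Suc[of g k "r x"] max_sum_nonneg[of g n "r x"] Suc
      by (auto simp: I_def max_def split: if_splits)
    then have "(\<integral>x. max_sum g n x - max_sum g n (r x) \<partial>\<mu>) \<le> (\<integral>x. I n x \<partial>\<mu>)"
      using integrable_max_sum[OF g, of n] by (intro integral_mono integral_comp_r I_int) (auto intro: integral_comp_r)
    then show ?thesis
      using integrable_max_sum[OF g, of n] by (simp add: integral_comp_r)
  qed
  have "(\<lambda>n. \<integral>x. I n x \<partial>\<mu>) \<longlonglongrightarrow> (\<integral>x. g x \<partial>\<mu>)"
  proof (rule integral_dominated_convergence)
    show "integrable \<mu> (\<lambda>x. \<bar>g x\<bar>)" using g by simp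
    show "AE x in \<mu>. (\<lambda>n. I n x) \<longlonglongrightarrow> g x"
      using pos
    proof eventually_elim
      case (elim x)
      then obtain N where "0 < max_sum g N x" by auto
      then have "0 < max_sum g n x" if "n \<ge> N" for n
        using monoD[OF max_sum_mono that, of g x] by simp
      then have "eventually (\<lambda>n. I n x = g x) sequentially"
        by (auto simp: I_def eventually_sequentially intro!: exI[of _ N])
      then show ?case by (rule tendsto_eventually)
    qed
  qed (auto simp: I_def)
  then show ?thesis
    using I_nonneg by (intro LIMSEQ_le_const) auto
qed

text \<open>Unboundedness of the maxima is unaffected by one step of \<open>r\<close>, so it defines
  an exactly invariant set, null or of full measure. Full measure would make the integral
  nonnegative by \<open>maximal_ergodic\<close>.\<close>

lemma ergodic_sums_bounded_above:
  fixes g :: "'a \<Rightarrow> real"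
  assumes erg: "ergodic r \<mu>" and g: "integrable \<mu> g" and neg: "(\<integral>x. g x \<partial>\<mu>) < 0"
  shows "AE x in \<mu>. \<exists>c. \<forall>n. (\<Sum>k<n. g ((r ^^ k) x)) \<le> c"
proof -
  have [measurable]: "g \<in> borel_measurable borel"
    using borel_measurable_integrable[OF g] by simp
  define A :: "'a set" where "A = {x. \<forall>c::nat. \<exists>n. real c < max_sum g n x}"
  have A_meas: "A \<in> sets borel" unfolding A_def by measurable
  have "x \<in> A \<longleftrightarrow> r x \<in> A" for x
  proof
    assume x: "x \<in> A"
    show "r x \<in> A" unfolding A_def
    proof safe
      fix c :: nat
      \<comment> \<open>One step along the orbit changes a sum by \<open>g x\<close>, so the
        threshold is raised by the absolute value of \<open>g x\<close>.\<close>
      obtain d :: nat where d: "real c + \<bar>g x\<bar> < real d" using reals_Archimedean2 by blast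
      obtain n where n: "real d < max_sum g n x" using x by (auto simp: A_def)
      with max_sum_le_Suc[of g n x] have "real d < max_sum g (Suc n) x" by linarith
      with d have "real c < max_sum g n (r x)" by (auto simp: max_def split: if_splits)
      then show "\<exists>n. real c < max_sum g n (r x)" by auto
    qed
  next
    assume x: "r x \<in> A"
    show "x \<in> A" unfolding A_def
    proof safe
      fix c :: nat
      obtain d :: nat where d: "real c + \<bar>g x\<bar> < real d" using reals_Archimedean2 by blast
      obtain n where n: "real d < max_sum g n (r x)" using x by (auto simp: A_def)
      with d have "real c < max_sum g (Suc n) x" by auto
      then show "\<exists>n. real c < max_sum g n x" by blast
    qed
  qed
  then have "r -` A = A" by auto
  then have "emeasure \<mu> A = 0 \<or> emeasure \<mu> A = 1"
    using erg A_meas by (auto simp: ergodic_def)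
  moreover have "emeasure \<mu> A \<noteq> 1"
  proof
    assume "emeasure \<mu> A = 1"
    then have "AE x in \<mu>. x \<in> A"
      using A_meas by (intro AE_prob_1) (simp add: emeasure_eq_measure)
    then have "AE x in \<mu>. \<exists>n. 0 < max_sum g n x"
      by eventually_elim (force simp: A_def dest: spec[of _ 0])
    from maximal_ergodic[OF g this] neg show False by simp
  qed
  ultimately have "AE x in \<mu>. x \<notin> A"
    using A_meas by (auto intro!: AE_not_in simp: null_sets_def)
  then show ?thesis
  proof eventually_elim
    case (elim x)
    then obtain c :: nat where "\<And>n. max_sum g n x \<le> real c" by (auto simp: A_def not_less)
    then show ?case using sum_le_max_sum[of g x] by (blast intro: order_trans)
  qed
qed

text \<open>Raising \<open>g\<close> by half of its drift keeps the integral negative, so the raised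
  sums are still bounded above; the original sums of length \<open>n\<close> then lie below
  \<open>c - n * e\<close>.\<close>

lemma ergodic_sums_tendsto_at_bot:
  fixes g :: "'a \<Rightarrow> real"
  assumes erg: "ergodic r \<mu>" and g: "integrable \<mu> g" and neg: "(\<integral>x. g x \<partial>\<mu>) < 0"
  shows "AE x in \<mu>. filterlim (\<lambda>n. \<Sum>k<n. g ((r ^^ k) x)) at_bot sequentially"
proof -
  define e where "e = - (\<integral>x. g x \<partial>\<mu>) / 2"
  have e: "0 < e" using neg by (simp add: e_def)
  have "AE x in \<mu>. \<exists>c. \<forall>n. (\<Sum>k<n. g ((r ^^ k) x) + e) \<le> c"
    using g neg by (intro ergodic_sums_bounded_above[OF erg]) (auto simp: e_def prob_space[simplified])
  then show ?thesis
  proof eventually_elim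
    case (elim x)
    then obtain c where c: "\<And>n. (\<Sum>k<n. g ((r ^^ k) x)) + real n * e \<le> c"
      by (auto simp: sum.distrib)
    have "filterlim (\<lambda>n. c - real n * e) at_bot sequentially"
      using e by real_asymp
    then show ?case
      by (rule filterlim_at_bot_mono) (use c in \<open>auto simp: le_diff_eq\<close>)
  qed
qed

end

section \<open>The path measure on the solenoid\<close>

text \<open>Total boundedness supplies a finite net for every radius \<open>1 / (n + 1)\<close>; the
  balls around all these nets form the countable family.\<close>

lemma compact_UNIV_countable_separating:
  assumes "compact (UNIV :: 'a::metric_space set)"
  obtains B :: "nat \<Rightarrow> 'a::metric_space set" where "\<And>i. open (B i)" "\<And>x y. x \<noteq> y \<Longrightarrow> \<exists>i. y \<in> B i \<and> x \<notin> B i"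
proof -
  have "\<exists>k::'a set. finite k \<and> UNIV \<subseteq> (\<Union>x\<in>k. ball x (inverse (real (Suc n))))" for n
    using assms unfolding compact_eq_totally_bounded by (auto elim!: allE[of _ "inverse (real (Suc n))"])
  then obtain k :: "nat \<Rightarrow> 'a set" where k: "\<And>n. finite (k n)"
    "\<And>n. UNIV \<subseteq> (\<Union>x\<in>k n. ball x (inverse (real (Suc n))))" by metis
  define \<B> where "\<B> = (\<Union>n. (\<lambda>x. ball x (inverse (real (Suc n)))) ` k n)"
  have "countable \<B>" unfolding \<B>_def using k(1) by (auto intro!: countable_UN countable_image intro: countable_finite)
  moreover have "\<B> \<noteq> {}" using k(2)[of 0] by (fastforce simp: \<B>_def)
  ultimately have range: "range (from_nat_into \<B>) = \<B>" by (rule range_from_nat_into[rotated])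
  show thesis
  proof (rule that)
    show "open (from_nat_into \<B> i)" for i
      using from_nat_into[OF \<open>\<B> \<noteq> {}\<close>, of i] by (auto simp: \<B>_def)
    fix x y :: 'a assume "x \<noteq> y"
    \<comment> \<open>A ball of radius below half the distance cannot contain both points.\<close>
    then have "0 < dist x y / 2" by simp
    then obtain n where n: "inverse (real (Suc n)) < dist x y / 2" using reals_Archimedean by blast
    have "y \<in> (\<Union>x\<in>k n. ball x (inverse (real (Suc n))))" using k(2)[of n] by blast
    then obtain c where c: "c \<in> k n" "dist c y < inverse (real (Suc n))" by auto
    have "dist x y \<le> dist c x + dist c y" by (metis dist_commute dist_triangle)
    then have "y \<in> ball c (inverse (real (Suc n)))" "x \<notin> ball c (inverse (real (Suc n)))"
      using c n by auto
    moreover have "ball c (inverse (real (Suc n))) \<in> \<B>"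
      using c by (auto simp: \<B>_def)
    then have "ball c (inverse (real (Suc n))) \<in> range (from_nat_into \<B>)"
      unfolding range .
    then obtain i where "ball c (inverse (real (Suc n))) = from_nat_into \<B> i"
      by (rule imageE)
    ultimately have "y \<in> from_nat_into \<B> i \<and> x \<notin> from_nat_into \<B> i" by (simp only: simp_thms)
    then show "\<exists>i. y \<in> from_nat_into \<B> i \<and> x \<notin> from_nat_into \<B> i" ..
  qed
qed

text \<open>Two values differ exactly when some separating set holds one but not the other, so the
  complement is a countable union. In an arbitrary metric space the diagonal may fail to be
  measurable for the product of the Borel sigma-algebras.\<close>

lemma sets_Collect_eq_compact:
  fixes f g :: "'b \<Rightarrow> 'a::metric_space"
  assumes "compact (UNIV :: 'a set)" and [measurable]: "f \<in> borel_measurable M" "g \<in> borel_measurable M"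
  shows "{x \<in> space M. f x = g x} \<in> sets M"
proof -
  obtain B :: "nat \<Rightarrow> 'a set" where B: "\<And>i. open (B i)" "\<And>x y. x \<noteq> y \<Longrightarrow> \<exists>i. y \<in> B i \<and> x \<notin> B i"
    using compact_UNIV_countable_separating[OF assms(1)] by metis
  have [measurable]: "B i \<in> sets borel" for i using B(1) by auto
  have "{x \<in> space M. f x = g x} = space M - (\<Union>i. {x \<in> space M. g x \<in> B i \<and> f x \<notin> B i})"
    using B(2) by auto
  then show ?thesis by simp
qed

lemma paths_0: "paths r x 0 = {\<lambda>k. if k = 0 then x else undefined}"
  by (auto simp: paths_def fun_eq_iff)

lemma paths_Suc: "paths r x (Suc n) = (\<lambda>(y, q). case_nat x q) ` (SIGMA y:r -` {x}. paths r y n)"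
proof (rule set_eqI, rule iffI)
  fix p assume p: "p \<in> paths r x (Suc n)"
  have "p = case_nat x (\<lambda>k. p (Suc k))"
    using p by (auto simp: paths_def fun_eq_iff split: nat.split)
  moreover have "(p (Suc 0), \<lambda>k. p (Suc k)) \<in> (SIGMA y:r -` {x}. paths r y n)"
    using p by (auto simp: paths_def)
  ultimately show "p \<in> (\<lambda>(y, q). case_nat x q) ` (SIGMA y:r -` {x}. paths r y n)"
    by (intro image_eqI) auto
next
  fix p assume "p \<in> (\<lambda>(y, q). case_nat x q) ` (SIGMA y:r -` {x}. paths r y n)"
  then show "p \<in> paths r x (Suc n)"
    by (auto simp: paths_def split: nat.split)
qed

section \<open>The transfer operator and the weights of cylinders\<close>

locale qmf_system = finite_to_one_system \<mu> r for \<mu> :: "'a::metric_space measure" and r +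
  fixes m0 :: "'a \<Rightarrow> complex"
  assumes qmf: "qmf r m0"
begin

lemma m0_measurable [measurable]: "m0 \<in> borel_measurable borel"
  using qmf by (simp add: qmf_def)

text \<open>The Ruelle operator with weight \<open>W\<close>, which is also the Markov operator of
  the walk to a random preimage.\<close>

definition transfer :: "('a \<Rightarrow> ennreal) \<Rightarrow> 'a \<Rightarrow> ennreal" where
  "transfer f x = (\<Sum>y\<in>r -` {x}. ennreal (W r m0 y) * f y)"

lemma W_nonneg: "0 \<le> W r m0 x"
  by (simp add: W_def)

lemma transfer_eq_fibre_avg: "transfer f x = fibre_avg (\<lambda>y. ennreal ((cmod (m0 y))\<^sup>2) * f y) x"
proof -
  have "ennreal (W r m0 y) = ennreal (1 / real (card (r -` {x}))) * ennreal ((cmod (m0 y))\<^sup>2)"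
    if "r y = x" for y
    using that by (subst ennreal_mult[symmetric]) (auto simp: W_def)
  then show ?thesis
    by (auto simp: transfer_def fibre_avg_def sum_distrib_left mult.assoc intro!: sum.cong)
qed

lemma transfer_measurable [measurable]: "f \<in> borel_measurable borel \<Longrightarrow> transfer f \<in> borel_measurable borel"
  unfolding transfer_eq_fibre_avg[abs_def] by measurable

text \<open>This is the filter identity; it makes the transition kernels below probability
  measures.\<close>

lemma transfer_one: "transfer (\<lambda>_. 1) x = 1"
proof -
  have "(\<Sum>y\<in>r -` {x}. W r m0 y) = (1 / real (card (r -` {x}))) * (\<Sum>y\<in>r -` {x}. (cmod (m0 y))\<^sup>2)"
    unfolding sum_distrib_left by (intro sum.cong) (auto simp: W_def)
  also have "\<dots> = 1" using qmf unfolding qmf_def by blast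
  finally show ?thesis
    by (simp add: transfer_def W_nonneg)
qed

lemma transfer_zero [simp]: "transfer (\<lambda>_. 0) x = 0"
  by (simp add: transfer_def)

text \<open>The duality between the transfer operator and composition with \<open>r\<close>. The
  change of variables along \<open>r_inf\<close> reduces to it.\<close>

lemma nn_integral_transfer:
  assumes [measurable]: "f \<in> borel_measurable borel" "g \<in> borel_measurable borel"
  shows "(\<integral>\<^sup>+x. g x * transfer f x \<partial>\<mu>) = (\<integral>\<^sup>+x. ennreal ((cmod (m0 x))\<^sup>2) * f x * g (r x) \<partial>\<mu>)"
proof -
  have "fibre_avg (\<lambda>x. ennreal ((cmod (m0 x))\<^sup>2) * f x * g (r x)) x = g x * transfer f x" for x
    unfolding transfer_eq_fibre_avg by (subst fibre_avg_mult_comp) (rule mult.commute)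
  then have "(\<integral>\<^sup>+x. g x * transfer f x \<partial>\<mu>) = (\<integral>\<^sup>+x. fibre_avg (\<lambda>x. ennreal ((cmod (m0 x))\<^sup>2) * f x * g (r x)) x \<partial>\<mu>)"
    by simp
  also have "\<dots> = (\<integral>\<^sup>+x. ennreal ((cmod (m0 x))\<^sup>2) * f x * g (r x) \<partial>\<mu>)"
    by (rule nn_integral_fibre_avg) measurable
  finally show ?thesis .
qed

text \<open>The \<open>P_x\<close>-expectation of the product of the \<open>fs k (x_k)\<close>.
  Functions rather than sets are needed so that the last coordinate can be absorbed into the one
  before it.\<close>

primrec cyl_weight :: "nat \<Rightarrow> (nat \<Rightarrow> 'a \<Rightarrow> ennreal) \<Rightarrow> 'a \<Rightarrow> ennreal" where
  "cyl_weight 0 fs = fs 0"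
| "cyl_weight (Suc n) fs = (\<lambda>x. fs 0 x * transfer (cyl_weight n (\<lambda>k. fs (Suc k))) x)"

lemma cyl_weight_measurable [measurable (raw)]:
  "(\<And>k. fs k \<in> borel_measurable borel) \<Longrightarrow> cyl_weight n fs \<in> borel_measurable borel"
  by (induction n arbitrary: fs) auto

text \<open>The recursion works at the first coordinate while a Markov chain grows at the last one;
  this identity connects the two.\<close>

lemma cyl_weight_Suc_last: "cyl_weight (Suc n) fs = cyl_weight n (fs(n := \<lambda>x. fs n x * transfer (fs (Suc n)) x))"
proof (induction n arbitrary: fs)
  case (Suc n)
  have "(\<lambda>k. (fs(Suc n := g)) (Suc k)) = (\<lambda>k. fs (Suc k))(n := g)" for g by auto
  then show ?case
    by (subst cyl_weight.simps(2), subst Suc.IH, subst cyl_weight.simps(2)) simp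
qed simp

lemma cyl_weight_eq_0: "k \<le> n \<Longrightarrow> fs k = (\<lambda>_. 0) \<Longrightarrow> cyl_weight n fs = (\<lambda>_. 0)"
proof (induction n arbitrary: fs k)
  case (Suc n)
  show ?case
  proof (cases k)
    case (Suc j)
    then have "cyl_weight n (\<lambda>k. fs (Suc k)) = (\<lambda>_. 0)" using Suc.prems by (intro Suc.IH[of j]) auto
    then show ?thesis by simp
  qed (use Suc.prems in simp)
qed simp

lemma finite_paths: "finite (paths r x n)"
  by (induction n arbitrary: x) (auto simp: paths_0 paths_Suc finite_fibre)

text \<open>A path from \<open>x\<close> is a preimage \<open>y\<close> followed by a path from
  \<open>y\<close>. The first factor \<open>W\<close> of the path is that of \<open>y\<close>, which
  is the summand of one transfer step.\<close>

lemma sum_paths_eq_cyl_weight: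
  "(\<Sum>p\<in>paths r x n. ennreal (\<Prod>k\<in>{1..n}. W r m0 (p k)) * (\<Prod>k\<le>n. fs k (p k))) = cyl_weight n fs x"
proof (induction n arbitrary: x fs)
  case 0
  show ?case by (simp add: paths_0)
next
  case (Suc n)
  have inj: "inj_on (\<lambda>(y, q). case_nat x q) (SIGMA y:r -` {x}. paths r y n)"
  proof -
    have "y = y' \<and> q = q'"
      if q: "q \<in> paths r y n" "q' \<in> paths r y' n" and eq: "case_nat x q = case_nat x q'" for y q y' q'
    proof -
      have "q k = q' k" for k using fun_cong[OF eq, of "Suc k"] by simp
      then have "q = q'" by auto
      with q show ?thesis by (auto simp: paths_def)
    qed
    then show ?thesis by (auto simp: inj_on_def)
  qed
  have W: "(\<Prod>k\<in>{1..Suc n}. W r m0 (case_nat x q k)) = W r m0 (q 0) * (\<Prod>k\<in>{1..n}. W r m0 (q k))" for q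
    by (simp only: One_nat_def prod.atLeast1_atMost_eq prod.lessThan_Suc_shift nat.case)
  have f: "(\<Prod>k\<le>Suc n. fs k (case_nat x q k)) = fs 0 x * (\<Prod>k\<le>n. fs (Suc k) (q k))" for q
    by (simp only: prod.atMost_Suc_shift nat.case)
  have "(\<Sum>p\<in>paths r x (Suc n). ennreal (\<Prod>k\<in>{1..Suc n}. W r m0 (p k)) * (\<Prod>k\<le>Suc n. fs k (p k))) =
    (\<Sum>(y, q)\<in>(SIGMA y:r -` {x}. paths r y n).
      ennreal (W r m0 (q 0) * (\<Prod>k\<in>{1..n}. W r m0 (q k))) * (fs 0 x * (\<Prod>k\<le>n. fs (Suc k) (q k))))"
    unfolding paths_Suc by (subst sum.reindex[OF inj]) (simp only: comp_def case_prod_unfold W f)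
  also have "\<dots> = (\<Sum>y\<in>r -` {x}. \<Sum>q\<in>paths r y n.
      ennreal (W r m0 (q 0) * (\<Prod>k\<in>{1..n}. W r m0 (q k))) * (fs 0 x * (\<Prod>k\<le>n. fs (Suc k) (q k))))"
    by (subst sum.Sigma) (auto simp: finite_fibre finite_paths)
  also have "\<dots> = (\<Sum>y\<in>r -` {x}. \<Sum>q\<in>paths r y n. fs 0 x * (ennreal (W r m0 y) *
      (ennreal (\<Prod>k\<in>{1..n}. W r m0 (q k)) * (\<Prod>k\<le>n. fs (Suc k) (q k)))))"
    by (intro sum.cong refl) (auto simp: paths_def ennreal_mult W_nonneg prod_nonneg mult_ac)
  also have "\<dots> = fs 0 x * (\<Sum>y\<in>r -` {x}. ennreal (W r m0 y) * cyl_weight n (\<lambda>k. fs (Suc k)) y)"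
    by (simp only: sum_distrib_left[symmetric] Suc.IH[of "\<lambda>k. fs (Suc k)"])
  finally show ?case by (simp add: transfer_def)
qed

lemma is_mu_inf_iff:
  "is_mu_inf r \<mu> m0 M \<longleftrightarrow> space M = sol r \<and> sets M = sets (sol_space r) \<and>
     (\<forall>n A. (\<forall>k. A k \<in> sets borel) \<longrightarrow>
        emeasure M {x \<in> sol r. \<forall>k\<le>n. x k \<in> A k} = (\<integral>\<^sup>+x. cyl_weight n (\<lambda>k. indicator (A k)) x \<partial>\<mu>))"
proof -
  have ind: "indicator {q. \<forall>k\<le>n. q k \<in> A k} p = (\<Prod>k\<le>n. indicator (A k) (p k) :: ennreal)"
    for A :: "nat \<Rightarrow> 'a set" and p n
    by (induction n) (auto simp: indicator_def le_Suc_eq)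
  have "(\<Sum>p\<in>paths r x n. ennreal (\<Prod>k\<in>{1..n}. W r m0 (p k)) * indicator {q. \<forall>k\<le>n. q k \<in> A k} p)
      = cyl_weight n (\<lambda>k. indicator (A k)) x" for A :: "nat \<Rightarrow> 'a set" and x n
    unfolding ind by (rule sum_paths_eq_cyl_weight)
  then show ?thesis unfolding is_mu_inf_def by simp
qed

section \<open>Existence of the path measure by the Ionescu-Tulcea theorem\<close>

definition kernel :: "'a \<Rightarrow> 'a measure" where
  "kernel x = distr (point_measure (r -` {x}) (\<lambda>y. ennreal (W r m0 y))) borel (\<lambda>y. y)"

lemma sets_kernel [simp, measurable_cong]: "sets (kernel x) = sets borel"
  by (simp add: kernel_def)

lemma nn_integral_kernel:
  assumes [measurable]: "f \<in> borel_measurable borel"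
  shows "(\<integral>\<^sup>+y. f y \<partial>kernel x) = transfer f x"
  unfolding kernel_def
  by (subst nn_integral_distr)
     (auto simp: point_measure_def nn_integral_point_measure_finite[unfolded point_measure_def] finite_fibre transfer_def
       intro!: sum.cong)

lemma emeasure_kernel: "A \<in> sets borel \<Longrightarrow> emeasure (kernel x) A = transfer (indicator A) x"
  using nn_integral_kernel[of "indicator A" x] by simp

lemma prob_space_kernel: "prob_space (kernel x)"
proof
  show "emeasure (kernel x) (space (kernel x)) = 1"
    using emeasure_kernel[of UNIV x] sets_eq_imp_space_eq[OF sets_kernel[of x]] by (simp add: transfer_one)
qed

lemma kernel_measurable [measurable]: "kernel \<in> measurable borel (subprob_algebra borel)"
proof (rule measurable_subprob_algebra)
  show "subprob_space (kernel a)" for a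
    using prob_space_kernel by (rule prob_space_imp_subprob_space)
  show "(\<lambda>a. emeasure (kernel a) A) \<in> borel_measurable borel" if "A \<in> sets borel" for A
    using that by (subst emeasure_kernel) (auto intro!: transfer_measurable)
qed simp

text \<open>Time 0 has law \<mu> instead of a point mass, so the limit is at once the \<mu>-mixture
  of the measures \<open>P_x\<close>; later steps look only at the preceding coordinate.\<close>

definition chain_step :: "nat \<Rightarrow> (nat \<Rightarrow> 'a) \<Rightarrow> 'a measure" where
  "chain_step i \<omega> = (case i of 0 \<Rightarrow> \<mu> | Suc j \<Rightarrow> kernel (\<omega> j))"

sublocale IT: Ionescu_Tulcea chain_step "\<lambda>_. borel"
proof (rule Ionescu_Tulcea.intro)
  fix i :: nat
  show "chain_step i \<in> measurable (Pi\<^sub>M {0..<i} (\<lambda>_. borel)) (subprob_algebra borel)"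
  proof (cases i)
    case 0
    have "\<mu> \<in> space (subprob_algebra borel)"
      by (auto simp: space_subprob_algebra prob_space_imp_subprob_space[OF prob_space_axioms])
    then show ?thesis using 0 by (simp add: chain_step_def[abs_def])
  next
    case (Suc j)
    then have "(\<lambda>\<omega>. kernel (\<omega> j)) \<in> measurable (Pi\<^sub>M {0..<i} (\<lambda>_. borel)) (subprob_algebra borel)"
      by (intro measurable_compose[OF _ kernel_measurable] measurable_component_singleton) auto
    then show ?thesis using Suc by (simp add: chain_step_def[abs_def])
  qed
  show "prob_space (chain_step i x)" for x
    by (cases i) (auto simp: chain_step_def prob_space_kernel prob_space_axioms)
qed

abbreviation "paths_law \<equiv> IT.PF.lim"

lemma nn_integral_C_Suc:
  assumes [measurable]: "f \<in> borel_measurable (Pi\<^sub>M {0..<Suc n} (\<lambda>_. borel))"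
  shows "(\<integral>\<^sup>+\<omega>. f \<omega> \<partial>IT.C 0 (Suc n) (\<lambda>_. undefined)) =
    (\<integral>\<^sup>+\<omega>. (\<integral>\<^sup>+x. f (fun_upd \<omega> n x) \<partial>chain_step n \<omega>) \<partial>IT.C 0 n (\<lambda>_. undefined))"
proof -
  have u: "(\<lambda>_. undefined) \<in> space (Pi\<^sub>M {0..<0} (\<lambda>_. borel))"
    by (auto simp: space_PiM PiE_iff extensional_def)
  have "(\<integral>\<^sup>+\<omega>. f \<omega> \<partial>IT.C 0 (Suc n) (\<lambda>_. undefined)) =
    (\<integral>\<^sup>+\<omega>. (\<integral>\<^sup>+x. f x \<partial>IT.eP n \<omega>) \<partial>IT.C 0 n (\<lambda>_. undefined))"
    unfolding IT.C.simps add_0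
  proof (rule nn_integral_bind[OF assms])
    show "IT.eP n \<in> measurable (IT.C 0 n (\<lambda>_. undefined)) (subprob_algebra (Pi\<^sub>M {0..<Suc n} (\<lambda>_. borel)))"
      using IT.measurable_eP[of n] unfolding measurable_cong_sets[OF IT.sets_C[OF u, of n] refl] add_0 .
  qed
  also have "\<dots> = (\<integral>\<^sup>+\<omega>. (\<integral>\<^sup>+x. f (fun_upd \<omega> n x) \<partial>chain_step n \<omega>) \<partial>IT.C 0 n (\<lambda>_. undefined))"
    using IT.space_C[OF u, of n] by (intro nn_integral_cong IT.nn_integral_eP) simp_all
  finally show ?thesis .
qed

text \<open>Integrating out the last coordinate against its kernel leaves a factor
  \<open>transfer (fs (Suc n))\<close> at coordinate \<open>n\<close>. The induction is over all
  \<open>fs\<close> because this factor alters the function there.\<close>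

lemma nn_integral_C_prod:
  assumes "\<And>k. fs k \<in> borel_measurable borel"
  shows "(\<integral>\<^sup>+\<omega>. (\<Prod>k\<le>n. fs k (\<omega> k)) \<partial>IT.C 0 (Suc n) (\<lambda>_. undefined)) = (\<integral>\<^sup>+x. cyl_weight n fs x \<partial>\<mu>)"
  using assms
proof (induction n arbitrary: fs)
  case 0
  note [measurable] = 0
  have "(\<integral>\<^sup>+\<omega>. (\<Prod>k\<le>0. fs k (\<omega> k)) \<partial>IT.C 0 (Suc 0) (\<lambda>_. undefined)) =
    (\<integral>\<^sup>+\<omega>. (\<integral>\<^sup>+x. fs 0 x \<partial>\<mu>) \<partial>IT.C 0 0 (\<lambda>_. undefined))"
  proof (subst nn_integral_C_Suc)
    show "(\<lambda>\<omega>. \<Prod>k\<le>0. fs k (\<omega> k)) \<in> borel_measurable (Pi\<^sub>M {0..<Suc 0} (\<lambda>_. borel))"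
      by (intro borel_measurable_prod_ennreal measurable_compose[OF _ 0] measurable_component_singleton) auto
  qed (simp add: chain_step_def)
  also have "\<dots> = (\<integral>\<^sup>+x. fs 0 x \<partial>\<mu>)"
    using IT.prob_space_C[of "\<lambda>_. undefined" 0 0]
    by (simp add: prob_space.emeasure_space_1 space_PiM PiE_iff extensional_def del: IT.C.simps)
  finally show ?case by simp
next
  case (Suc n)
  note [measurable] = Suc.prems
  define fs' where "fs' = fs(n := \<lambda>x. fs n x * transfer (fs (Suc n)) x)"
  have fs' [measurable]: "fs' k \<in> borel_measurable borel" for k
    by (cases "k = n") (auto simp: fs'_def)
  have prod: "(\<Prod>k\<le>n. fs' k (\<omega> k)) = (\<Prod>k\<le>n. fs k (\<omega> k)) * transfer (fs (Suc n)) (\<omega> n)" for \<omega>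
  proof (cases n)
    case (Suc m)
    have "(\<Prod>k\<le>m. fs' k (\<omega> k)) = (\<Prod>k\<le>m. fs k (\<omega> k))"
      using Suc by (intro prod.cong) (auto simp: fs'_def)
    then show ?thesis using Suc by (simp add: fs'_def mult.assoc)
  qed (simp add: fs'_def)
  have "(\<integral>\<^sup>+\<omega>. (\<Prod>k\<le>Suc n. fs k (\<omega> k)) \<partial>IT.C 0 (Suc (Suc n)) (\<lambda>_. undefined)) =
    (\<integral>\<^sup>+\<omega>. (\<integral>\<^sup>+x. (\<Prod>k\<le>n. fs k (\<omega> k)) * fs (Suc n) x \<partial>chain_step (Suc n) \<omega>) \<partial>IT.C 0 (Suc n) (\<lambda>_. undefined))"
  proof (subst nn_integral_C_Suc)
    show "(\<lambda>\<omega>. \<Prod>k\<le>Suc n. fs k (\<omega> k)) \<in> borel_measurable (Pi\<^sub>M {0..<Suc (Suc n)} (\<lambda>_. borel))"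
      by (intro borel_measurable_prod_ennreal measurable_compose[OF _ Suc.prems] measurable_component_singleton) auto
    have "(\<Prod>k\<le>n. fs k (fun_upd \<omega> (Suc n) x k)) = (\<Prod>k\<le>n. fs k (\<omega> k))" for \<omega> x
      by (intro prod.cong) auto
    then show "(\<integral>\<^sup>+\<omega>. (\<integral>\<^sup>+x. (\<Prod>k\<le>Suc n. fs k (fun_upd \<omega> (Suc n) x k)) \<partial>chain_step (Suc n) \<omega>) \<partial>IT.C 0 (Suc n) (\<lambda>_. undefined)) =
      (\<integral>\<^sup>+\<omega>. (\<integral>\<^sup>+x. (\<Prod>k\<le>n. fs k (\<omega> k)) * fs (Suc n) x \<partial>chain_step (Suc n) \<omega>) \<partial>IT.C 0 (Suc n) (\<lambda>_. undefined))"
      by simp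
  qed
  also have "\<dots> = (\<integral>\<^sup>+\<omega>. (\<Prod>k\<le>n. fs' k (\<omega> k)) \<partial>IT.C 0 (Suc n) (\<lambda>_. undefined))"
  proof (rule nn_integral_cong)
    fix \<omega>
    have "fs (Suc n) \<in> borel_measurable (kernel (\<omega> n))"
      using Suc.prems[of "Suc n"] by (simp add: measurable_cong_sets[OF sets_kernel refl])
    then show "(\<integral>\<^sup>+x. (\<Prod>k\<le>n. fs k (\<omega> k)) * fs (Suc n) x \<partial>chain_step (Suc n) \<omega>) = (\<Prod>k\<le>n. fs' k (\<omega> k))"
      unfolding prod by (simp add: chain_step_def nn_integral_cmult nn_integral_kernel Suc.prems)
  qed
  also have "\<dots> = (\<integral>\<^sup>+x. cyl_weight n fs' x \<partial>\<mu>)" by (rule Suc.IH[OF fs'])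
  also have "cyl_weight n fs' = cyl_weight (Suc n) fs" unfolding fs'_def cyl_weight_Suc_last ..
  finally show ?case .
qed

lemma emeasure_paths_law:
  assumes A [measurable]: "\<And>k. A k \<in> sets borel"
  shows "emeasure paths_law {x. \<forall>k\<le>n. x k \<in> A k} = (\<integral>\<^sup>+x. cyl_weight n (\<lambda>k. indicator (A k)) x \<partial>\<mu>)"
proof -
  let ?J = "{0..<Suc n}" and ?u = "\<lambda>_::nat. undefined :: 'a"
  have X: "Pi\<^sub>E ?J A \<in> sets (Pi\<^sub>M ?J (\<lambda>_. borel))" by (rule sets_PiM_I_finite) auto
  have u: "?u \<in> space (Pi\<^sub>M {0..<0} (\<lambda>_. borel))"
    by (auto simp: space_PiM PiE_iff extensional_def)
  have "{x. \<forall>k\<le>n. x k \<in> A k} = IT.PF.emb UNIV ?J (Pi\<^sub>E ?J A)"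
    by (auto simp: prod_emb_def PiE_iff less_Suc_eq_le)
  then have "emeasure paths_law {x. \<forall>k\<le>n. x k \<in> A k} = emeasure (IT.CI ?J) (Pi\<^sub>E ?J A)"
    using IT.lim[OF _ X] by simp
  also have "\<dots> = emeasure (IT.C 0 (Suc n) ?u) (IT.PF.emb ?J ?J (Pi\<^sub>E ?J A))"
    by (rule IT.emeasure_CI[OF _ X]) simp
  also have "IT.PF.emb ?J ?J (Pi\<^sub>E ?J A) = Pi\<^sub>E ?J A"
    using sets.sets_into_space[OF X] by (intro prod_emb_id) (simp add: space_PiM)
  also have "emeasure (IT.C 0 (Suc n) ?u) (Pi\<^sub>E ?J A) =
      (\<integral>\<^sup>+\<omega>. indicator (Pi\<^sub>E ?J A) \<omega> \<partial>IT.C 0 (Suc n) ?u)"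
    using X IT.sets_C[OF u, of "Suc n"] by (subst nn_integral_indicator) (simp_all del: IT.C.simps)
  also have "\<dots> = (\<integral>\<^sup>+\<omega>. (\<Prod>k\<le>n. indicator (A k) (\<omega> k)) \<partial>IT.C 0 (Suc n) ?u)"
  proof (rule nn_integral_cong)
    fix \<omega> assume "\<omega> \<in> space (IT.C 0 (Suc n) ?u)"
    then have "\<omega> \<in> extensional ?J"
      using IT.space_C[OF u, of "Suc n"] by (simp add: space_PiM PiE_def del: IT.C.simps)
    then have "indicator (Pi\<^sub>E ?J A) \<omega> = (indicator {q. \<forall>k\<le>n. q k \<in> A k} \<omega> :: ennreal)"
      by (auto simp: indicator_def PiE_iff less_Suc_eq_le)
    also have "\<dots> = (\<Prod>k\<le>n. indicator (A k) (\<omega> k))"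
      by (induction n) (auto simp: indicator_def le_Suc_eq)
    finally show "indicator (Pi\<^sub>E ?J A) \<omega> = (\<Prod>k\<le>n. indicator (A k) (\<omega> k) :: ennreal)" .
  qed
  also have "\<dots> = (\<integral>\<^sup>+x. cyl_weight n (\<lambda>k. indicator (A k)) x \<partial>\<mu>)"
    by (rule nn_integral_C_prod) simp
  finally show ?thesis .
qed

lemma sol_sets [measurable]: "sol r \<in> sets (Pi\<^sub>M UNIV (\<lambda>_. borel))"
proof -
  have "{x \<in> space (Pi\<^sub>M UNIV (\<lambda>_. borel)). r (x (Suc n)) = x n} \<in> sets (Pi\<^sub>M UNIV (\<lambda>_::nat. borel))" for n
    by (rule sets_Collect_eq_compact[OF compact_UNIV]) measurable
  moreover have "sol r = (\<Inter>n. {x \<in> space (Pi\<^sub>M UNIV (\<lambda>_. borel)). r (x (Suc n)) = x n})"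
    by (auto simp: sol_def space_PiM)
  ultimately show ?thesis by simp
qed

text \<open>The chain lives on all sequences. A violated equation is noticed by some separating set,
  hence happens inside one of countably many cylinders, all of weight 0.\<close>

lemma AE_paths_law_sol: "AE x in paths_law. x \<in> sol r"
proof -
  obtain B :: "nat \<Rightarrow> 'a set" where B: "\<And>i. open (B i)" "\<And>x y. x \<noteq> y \<Longrightarrow> \<exists>i. y \<in> B i \<and> x \<notin> B i"
    using compact_UNIV_countable_separating[OF compact_UNIV] by metis
  have [measurable]: "B i \<in> sets borel" for i using B(1) by auto
  have null: "AE x in paths_law. \<not> (r (x (Suc n)) \<in> B i \<and> x n \<notin> B i)" for n i
  proof -
    define A where "A k = (if k = n then - B i else if k = Suc n then r -` B i else UNIV)" for k
    have [measurable]: "A k \<in> sets borel" for k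
      using measurable_sets[OF r_measurable, of "B i"] by (auto simp: A_def)
    \<comment> \<open>\<open>transfer\<close> at \<open>x\<close> sees only the \<open>y\<close>
      with \<open>r y = x\<close>, and for \<open>x\<close> outside \<open>B i\<close> none of them
      lies in the preimage of \<open>B i\<close>.\<close>
    have "(\<lambda>x. indicator (A n) x * transfer (indicator (A (Suc n))) x) = (\<lambda>_. 0)"
      by (intro ext) (auto simp: A_def transfer_def indicator_def intro!: sum.neutral)
    then have "cyl_weight (Suc n) (\<lambda>k. indicator (A k)) = (\<lambda>_. 0)"
      unfolding cyl_weight_Suc_last by (intro cyl_weight_eq_0[of n]) auto
    then have "emeasure paths_law {x. \<forall>k\<le>Suc n. x k \<in> A k} = 0"
      by (subst emeasure_paths_law) auto
    moreover have eq: "{x. \<forall>k\<le>Suc n. x k \<in> A k} = {x. r (x (Suc n)) \<in> B i \<and> x n \<notin> B i}"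
    proof (rule Collect_cong)
      fix x
      have "(\<forall>k\<le>Suc n. x k \<in> A k) \<longleftrightarrow> x n \<in> A n \<and> x (Suc n) \<in> A (Suc n)"
        unfolding A_def by (metis UNIV_I le_Suc_eq order_refl)
      then show "(\<forall>k\<le>Suc n. x k \<in> A k) \<longleftrightarrow> r (x (Suc n)) \<in> B i \<and> x n \<notin> B i"
        by (simp add: A_def conj_commute)
    qed
    moreover have "{x \<in> space (Pi\<^sub>M UNIV (\<lambda>_. borel)). r (x (Suc n)) \<in> B i \<and> x n \<notin> B i} \<in> sets (Pi\<^sub>M UNIV (\<lambda>_::nat. borel))"
      by measurable
    ultimately have "{x. r (x (Suc n)) \<in> B i \<and> x n \<notin> B i} \<in> null_sets paths_law"
      by (auto simp: null_sets_def IT.PF.sets_lim space_PiM)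
    then show ?thesis by (auto dest: AE_not_in)
  qed
  have "AE x in paths_law. \<forall>n i. \<not> (r (x (Suc n)) \<in> B i \<and> x n \<notin> B i)"
    using null by (simp add: AE_all_countable)
  then show ?thesis
  proof eventually_elim
    case (elim x)
    have "r (x (Suc n)) = x n" for n
    proof (rule ccontr)
      assume "r (x (Suc n)) \<noteq> x n"
      then show False using B(2)[of "x n" "r (x (Suc n))"] elim by metis
    qed
    then show ?case by (simp add: sol_def)
  qed
qed

lemma ex_mu_inf: "\<exists>M. is_mu_inf r \<mu> m0 M"
proof
  have sp: "space paths_law = UNIV" by (simp add: IT.PF.space_lim space_PiM)
  have se: "sets paths_law = sets (Pi\<^sub>M UNIV (\<lambda>_. borel))" by (rule IT.PF.sets_lim)
  have "emeasure (restrict_space paths_law (sol r)) {x \<in> sol r. \<forall>k\<le>n. x k \<in> A k} =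
      emeasure paths_law {x. \<forall>k\<le>n. x k \<in> A k}" if A [measurable]: "\<And>k. A k \<in> sets borel" for A n
  proof -
    have "{x \<in> space (Pi\<^sub>M UNIV (\<lambda>_. borel)). \<forall>k\<le>n. x k \<in> A k} \<in> sets (Pi\<^sub>M UNIV (\<lambda>_::nat. borel))"
      by measurable
    then have *: "{x. \<forall>k\<le>n. x k \<in> A k} \<in> sets (Pi\<^sub>M UNIV (\<lambda>_. borel))"
    by (auto simp: space_PiM PiE_iff extensional_def)
    then have **: "{x \<in> sol r. \<forall>k\<le>n. x k \<in> A k} \<in> sets (Pi\<^sub>M UNIV (\<lambda>_. borel))"
      using sets.Int[OF sol_sets *] by (simp add: Int_def)
    have "emeasure (restrict_space paths_law (sol r)) {x \<in> sol r. \<forall>k\<le>n. x k \<in> A k} =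
      emeasure paths_law {x \<in> sol r. \<forall>k\<le>n. x k \<in> A k}"
      by (rule emeasure_restrict_space) (auto simp: sp se)
    also have "\<dots> = emeasure paths_law {x. \<forall>k\<le>n. x k \<in> A k}"
      using AE_paths_law_sol * ** by (intro emeasure_eq_AE) (auto simp: se)
    finally show ?thesis .
  qed
  then show "is_mu_inf r \<mu> m0 (restrict_space paths_law (sol r))"
    unfolding is_mu_inf_iff using emeasure_paths_law
    by (auto simp: space_restrict_space sp sol_space_def intro!: restrict_space_sets_cong[OF refl se])
qed

end

section \<open>Change of variables along the shift\<close>

locale solenoid_system = qmf_system \<mu> r m0 for \<mu> :: "'a::metric_space measure" and r m0 +
  fixes M :: "(nat \<Rightarrow> 'a) measure"
  assumes M: "is_mu_inf r \<mu> m0 M"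
    and m0_nonzero: "AE x in \<mu>. m0 x \<noteq> 0"
begin

lemma space_M [simp]: "space M = sol r"
  and sets_M: "sets M = sets (restrict_space (Pi\<^sub>M UNIV (\<lambda>_. borel)) (sol r))"
  and emeasure_cylinder: "(\<And>k. A k \<in> sets borel) \<Longrightarrow>
    emeasure M {x \<in> sol r. \<forall>k\<le>n. x k \<in> A k} = (\<integral>\<^sup>+x. cyl_weight n (\<lambda>k. indicator (A k)) x \<partial>\<mu>)"
  using M unfolding is_mu_inf_iff sol_space_def by blast+

lemma coord_measurable [measurable]: "(\<lambda>z. z k) \<in> borel_measurable M"
  unfolding measurable_cong_sets[OF sets_M refl]
  by (intro measurable_restrict_space1) measurable

lemma measurable_into_M:
  assumes "\<And>z. z \<in> space N \<Longrightarrow> h z \<in> sol r" "\<And>k. (\<lambda>z. h z k) \<in> borel_measurable N"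
  shows "h \<in> measurable N M"
  unfolding measurable_cong_sets[OF refl sets_M] using assms
  by (intro measurable_restrict_space2 measurable_PiM_single') auto

lemma cylinder_sets:
  assumes A: "\<And>k. A k \<in> sets borel"
  shows "{x \<in> sol r. \<forall>k\<le>n. x k \<in> A k} \<in> sets M"
proof -
  have "(\<lambda>x. x k) -` A k \<inter> space M \<in> sets M" for k
    by (rule measurable_sets[OF coord_measurable A])
  then have "(\<Inter>k\<in>{..n}. (\<lambda>x. x k) -` A k \<inter> space M) \<in> sets M"
    by (intro sets.finite_INT) auto
  moreover have "(\<Inter>k\<in>{..n}. (\<lambda>x. x k) -` A k \<inter> space M) = {x \<in> sol r. \<forall>k\<le>n. x k \<in> A k}"
    by auto
  ultimately show ?thesis by (simp only:)
qed

lemma emeasure_M_space: "emeasure M (sol r) = 1"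
  using emeasure_cylinder[of "\<lambda>_. UNIV" 0] emeasure_space_1 by simp

sublocale M: prob_space M
  by standard (simp add: emeasure_M_space)

lemma distr_coord_0: "distr M \<mu> (\<lambda>z. z 0) = \<mu>"
proof (rule measure_eqI)
  fix B assume "B \<in> sets (distr M \<mu> (\<lambda>z. z 0))"
  then have B [measurable]: "B \<in> sets borel" by simp
  have "(\<lambda>z. z 0) -` B \<inter> sol r = {x \<in> sol r. \<forall>k\<le>0. x k \<in> B}" by auto
  then show "emeasure (distr M \<mu> (\<lambda>z. z 0)) B = emeasure \<mu> B"
    using emeasure_cylinder[of "\<lambda>_. B" 0] by (simp add: emeasure_distr)
qed simp

lemma AE_coord_0:
  assumes "AE x in \<mu>. P x" shows "AE z in M. P (z 0)"
proof -
  have "AE x in distr M \<mu> (\<lambda>z. z 0). P x" unfolding distr_coord_0 by (rule assms)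
  then show ?thesis by (rule AE_distrD[rotated]) simp
qed

text \<open>Intersecting the first side of a cylinder with \<open>B\<close> gives another cylinder,
  so the cylinder values determine the law of \<open>z 0\<close> on a cylinder. Weights in
  \<open>z 0\<close> are needed since the density \<open>|m0|^2\<close> sits at that
  coordinate.\<close>

lemma nn_integral_coord_0_cylinder:
  assumes A [measurable]: "\<And>k. A k \<in> sets borel" and g [measurable]: "g \<in> borel_measurable borel"
  shows "(\<integral>\<^sup>+z. indicator {x \<in> sol r. \<forall>k\<le>n. x k \<in> A k} z * g (z 0) \<partial>M) =
    (\<integral>\<^sup>+x. cyl_weight n (\<lambda>k. indicator (A k)) x * g x \<partial>\<mu>)"
proof -
  let ?C = "{x \<in> sol r. \<forall>k\<le>n. x k \<in> A k}" and ?Q = "cyl_weight n (\<lambda>k. indicator (A k))"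
  have C [measurable]: "?C \<in> sets M" by (rule cylinder_sets[OF A])
  have eq: "distr (density M (indicator ?C)) \<mu> (\<lambda>z. z 0) = density \<mu> ?Q"
  proof (rule measure_eqI)
    fix B assume "B \<in> sets (distr (density M (indicator ?C)) \<mu> (\<lambda>z. z 0))"
    then have B [measurable]: "B \<in> sets borel" by simp
    define A' where "A' = A(0 := A 0 \<inter> B)"
    have [measurable]: "A' k \<in> sets borel" for k by (simp add: A'_def)
    have Q: "cyl_weight n (\<lambda>k. indicator (A' k)) x = ?Q x * indicator B x" for x
      by (cases n) (auto simp: A'_def indicator_def)
    have B' [measurable]: "(\<lambda>z. z 0) -` B \<inter> sol r \<in> sets M"
      using measurable_sets[OF coord_measurable[of 0] B] by simp
    have "emeasure (distr (density M (indicator ?C)) \<mu> (\<lambda>z. z 0)) B =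
        emeasure (density M (indicator ?C)) ((\<lambda>z. z 0) -` B \<inter> sol r)"
      by (subst emeasure_distr) auto
    also have "\<dots> = (\<integral>\<^sup>+z. indicator ?C z * indicator ((\<lambda>z. z 0) -` B \<inter> sol r) z \<partial>M)"
      by (rule emeasure_density[OF borel_measurable_indicator[OF C] B'])
    also have "\<dots> = (\<integral>\<^sup>+z. indicator (?C \<inter> ((\<lambda>z. z 0) -` B \<inter> sol r)) z \<partial>M)"
      by (simp only: indicator_inter_arith)
    also have "\<dots> = emeasure M (?C \<inter> ((\<lambda>z. z 0) -` B \<inter> sol r))"
      by (rule nn_integral_indicator[OF sets.Int[OF C B']])
    also have "?C \<inter> ((\<lambda>z. z 0) -` B \<inter> sol r) = {x \<in> sol r. \<forall>k\<le>n. x k \<in> A' k}"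
    proof -
      have "(\<forall>k\<le>n. x k \<in> A' k) \<longleftrightarrow> (\<forall>k\<le>n. x k \<in> A k) \<and> x 0 \<in> B" for x
        unfolding A'_def by (metis IntE IntI fun_upd_apply le0)
      then show ?thesis by blast
    qed
    also have "emeasure M \<dots> = (\<integral>\<^sup>+x. ?Q x * indicator B x \<partial>\<mu>)"
      unfolding Q[symmetric] by (rule emeasure_cylinder) simp
    also have "\<dots> = emeasure (density \<mu> ?Q) B"
      by (subst emeasure_density) auto
    finally show "emeasure (distr (density M (indicator ?C)) \<mu> (\<lambda>z. z 0)) B = emeasure (density \<mu> ?Q) B" .
  qed simp
  have "(\<integral>\<^sup>+z. indicator ?C z * g (z 0) \<partial>M) = (\<integral>\<^sup>+z. g (z 0) \<partial>density M (indicator ?C))"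
    by (subst nn_integral_density) auto
  also have "\<dots> = (\<integral>\<^sup>+x. g x \<partial>distr (density M (indicator ?C)) \<mu> (\<lambda>z. z 0))"
    by (subst nn_integral_distr) auto
  also have "\<dots> = (\<integral>\<^sup>+x. ?Q x * g x \<partial>\<mu>)"
    unfolding eq by (subst nn_integral_density) auto
  finally show ?thesis .
qed

lemma r_inf_sol: "z \<in> sol r \<Longrightarrow> r_inf r z \<in> sol r"
  unfolding sol_def
proof (intro CollectI allI)
  fix n assume "z \<in> {x. \<forall>n. r (x (Suc n)) = x n}"
  then show "r (r_inf r z (Suc n)) = r_inf r z n" by (cases n) (auto simp: r_inf_def)
qed

lemma lshift_sol: "z \<in> sol r \<Longrightarrow> lshift z \<in> sol r"
  by (simp add: sol_def lshift_def)

lemma r_inf_lshift: "z \<in> sol r \<Longrightarrow> r_inf r (lshift z) = z"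
  by (rule ext) (simp add: sol_def r_inf_def lshift_def)

lemma lshift_r_inf: "lshift (r_inf r z) = z"
  by (rule ext) (simp add: r_inf_def lshift_def)

lemma r_inf_measurable [measurable]: "r_inf r \<in> measurable M M"
proof (rule measurable_into_M)
  show "(\<lambda>z. r_inf r z k) \<in> borel_measurable M" for k
    by (cases k) (auto simp: r_inf_def)
qed (simp add: r_inf_sol)

lemma lshift_measurable [measurable]: "lshift \<in> measurable M M"
proof (rule measurable_into_M)
  show "(\<lambda>z. lshift z k) \<in> borel_measurable M" for k
    by (simp add: lshift_def)
qed (simp add: lshift_sol)

text \<open>At least two sides are listed, so that after pulling back along \<open>r_inf\<close> at
  least one side still constrains \<open>z\<close>. Shorter cylinders are covered by taking
  \<open>UNIV\<close> as a side.\<close>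

definition cylinders :: "(nat \<Rightarrow> 'a) set set" where
  "cylinders = {{x \<in> sol r. \<forall>k\<le>Suc n. x k \<in> A k} | n A. \<forall>k. A k \<in> sets borel}"

lemma Int_stable_cylinders: "Int_stable cylinders"
proof (rule Int_stableI)
  fix C D assume "C \<in> cylinders" "D \<in> cylinders"
  then obtain n A m B where A: "\<forall>k. A k \<in> sets borel" "C = {x \<in> sol r. \<forall>k\<le>Suc n. x k \<in> A k}"
    and B: "\<forall>k. B k \<in> sets borel" "D = {x \<in> sol r. \<forall>k\<le>Suc m. x k \<in> B k}"
    unfolding cylinders_def by blast
  have [measurable]: "A k \<in> sets borel" "B k \<in> sets borel" for k using A B by auto
  define E where "E k = {y \<in> space borel. (k \<le> Suc n \<longrightarrow> y \<in> A k) \<and> (k \<le> Suc m \<longrightarrow> y \<in> B k)}" for k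
  have "C \<inter> D = {x \<in> sol r. \<forall>k\<le>max (Suc n) (Suc m). x k \<in> E k}"
    unfolding A B by (auto simp: E_def le_max_iff_disj)
  then have "C \<inter> D = {x \<in> sol r. \<forall>k\<le>Suc (max n m). x k \<in> E k}" by simp
  moreover have "\<forall>k. E k \<in> sets borel" unfolding E_def by measurable
  ultimately show "C \<inter> D \<in> cylinders" unfolding cylinders_def by blast
qed

lemma sets_M_eq_cylinders: "sets M = sigma_sets (sol r) cylinders"
proof (rule antisym)
  let ?G = "{{f \<in> \<Pi>\<^sub>E i\<in>UNIV. space borel. f i \<in> A} | i A. i \<in> (UNIV::nat set) \<and> A \<in> sets (borel :: 'a measure)}"
  have PiM: "sets (Pi\<^sub>M UNIV (\<lambda>_::nat. borel :: 'a measure)) = sigma_sets (\<Pi>\<^sub>E i\<in>UNIV. space borel) ?G"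
    by (rule sets_PiM_single)
  have "sets M = (\<inter>) (sol r) ` sigma_sets (\<Pi>\<^sub>E i\<in>UNIV. space borel) ?G"
    unfolding sets_M sets_restrict_space PiM ..
  also have "\<dots> = sigma_sets (sol r) ((\<inter>) (sol r) ` ?G)"
    using sol_sets unfolding PiM by (intro sigma_sets_Int) auto
  also have "\<dots> \<subseteq> sigma_sets (sol r) cylinders"
  proof (rule sigma_sets_mono')
    show "(\<inter>) (sol r) ` ?G \<subseteq> cylinders"
    proof clarify
      fix i :: nat and A :: "'a set" assume "A \<in> sets borel"
      moreover have "(\<forall>k\<le>Suc i. x k \<in> (if k = i then A else UNIV)) \<longleftrightarrow> x i \<in> A" for x
        by (metis UNIV_I le_Suc_eq order_refl)
      then have "sol r \<inter> {f \<in> \<Pi>\<^sub>E i\<in>UNIV. space borel. f i \<in> A} =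
          {x \<in> sol r. \<forall>k\<le>Suc i. x k \<in> (if k = i then A else UNIV)}"
        by auto
      ultimately show "sol r \<inter> {f \<in> \<Pi>\<^sub>E i\<in>UNIV. space borel. f i \<in> A} \<in> cylinders"
        unfolding cylinders_def
        by (intro CollectI exI[of _ i] exI[of _ "\<lambda>k. if k = i then A else UNIV"]) simp
    qed
  qed
  finally show "sets M \<subseteq> sigma_sets (sol r) cylinders" .
  have "cylinders \<subseteq> sets M" unfolding cylinders_def using cylinder_sets by blast
  then show "sigma_sets (sol r) cylinders \<subseteq> sets M"
    using sets.sigma_sets_subset[of cylinders M] by simp
qed

text \<open>Both measures are finite, so cylinders decide. There the claim is
  \<open>nn_integral_transfer\<close>, since side 0 stands in front of one transfer step in
  \<open>cyl_weight\<close>.\<close>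

lemma distr_r_inf: "distr (density M (\<lambda>z. ennreal ((cmod (m0 (z 0)))\<^sup>2))) M (r_inf r) = M"
proof (rule measure_eqI_generator_eq[OF Int_stable_cylinders])
  show "cylinders \<subseteq> Pow (sol r)" by (auto simp: cylinders_def)
  show "sets M = sigma_sets (sol r) cylinders"
    "sets (distr (density M (\<lambda>z. ennreal ((cmod (m0 (z 0)))\<^sup>2))) M (r_inf r)) = sigma_sets (sol r) cylinders"
    by (simp_all add: sets_M_eq_cylinders)
  fix X assume X: "X \<in> cylinders"
  then obtain n A where A: "\<forall>k. A k \<in> sets borel" and X_eq: "X = {x \<in> sol r. \<forall>k\<le>Suc n. x k \<in> A k}"
    unfolding cylinders_def by blast
  have [measurable]: "A k \<in> sets borel" for k using A by simp
  have X_sets [measurable]: "X \<in> sets M" unfolding X_eq using A by (intro cylinder_sets) simp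
  let ?C = "{x \<in> sol r. \<forall>k\<le>n. x k \<in> A (Suc k)}"
  let ?g = "\<lambda>x. ennreal ((cmod (m0 x))\<^sup>2) * indicator (A 0) (r x)"
  \<comment> \<open>\<open>r_inf\<close> moves coordinates one place to the right: the last
    \<open>n + 1\<close> sides constrain \<open>z\<close> itself, the first one constrains
    \<open>r (z 0)\<close>.\<close>
  have X_r: "indicator X (r_inf r z) = (indicator ?C z * indicator (A 0) (r (z 0)) :: ennreal)" if "z \<in> sol r" for z
  proof -
    have "r_inf r z \<in> X \<longleftrightarrow> (\<forall>k\<le>Suc n. r_inf r z k \<in> A k)"
      using r_inf_sol[OF that] by (simp add: X_eq)
    also have "\<dots> \<longleftrightarrow> r (z 0) \<in> A 0 \<and> (\<forall>k\<le>n. z k \<in> A (Suc k))"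
      using All_less_Suc2[of "Suc n" "\<lambda>k. r_inf r z k \<in> A k"] by (simp add: r_inf_def less_Suc_eq_le)
    finally show ?thesis using that by (auto simp: indicator_def)
  qed
  have "emeasure (distr (density M (\<lambda>z. ennreal ((cmod (m0 (z 0)))\<^sup>2))) M (r_inf r)) X =
      (\<integral>\<^sup>+z. indicator X z \<partial>distr (density M (\<lambda>z. ennreal ((cmod (m0 (z 0)))\<^sup>2))) M (r_inf r))"
    by simp
  also have "\<dots> = (\<integral>\<^sup>+z. ennreal ((cmod (m0 (z 0)))\<^sup>2) * indicator X (r_inf r z) \<partial>M)"
    by (subst nn_integral_distr, simp, simp, subst nn_integral_density) auto
  also have "\<dots> = (\<integral>\<^sup>+z. indicator ?C z * ?g (z 0) \<partial>M)"
    by (intro nn_integral_cong) (simp add: X_r mult_ac)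
  also have "\<dots> = (\<integral>\<^sup>+x. cyl_weight n (\<lambda>k. indicator (A (Suc k))) x * ?g x \<partial>\<mu>)"
    by (rule nn_integral_coord_0_cylinder) auto
  also have "\<dots> = (\<integral>\<^sup>+x. ennreal ((cmod (m0 x))\<^sup>2) * cyl_weight n (\<lambda>k. indicator (A (Suc k))) x * indicator (A 0) (r x) \<partial>\<mu>)"
    by (simp add: mult_ac)
  also have "\<dots> = (\<integral>\<^sup>+x. indicator (A 0) x * transfer (cyl_weight n (\<lambda>k. indicator (A (Suc k)))) x \<partial>\<mu>)"
    by (rule nn_integral_transfer[symmetric]) auto
  also have "\<dots> = emeasure M X"
    unfolding X_eq using A by (subst emeasure_cylinder) auto
  finally show "emeasure (distr (density M (\<lambda>z. ennreal ((cmod (m0 (z 0)))\<^sup>2))) M (r_inf r)) X = emeasure M X" .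
next
  have D: "emeasure (distr (density M (\<lambda>z. ennreal ((cmod (m0 (z 0)))\<^sup>2))) M (r_inf r)) (sol r) \<noteq> \<infinity>"
    (is "?e \<noteq> _")
  proof -
    have "?e = (\<integral>\<^sup>+z. 1 \<partial>distr (density M (\<lambda>z. ennreal ((cmod (m0 (z 0)))\<^sup>2))) M (r_inf r))"
      by simp
    also have "\<dots> = (\<integral>\<^sup>+z. ennreal ((cmod (m0 (z 0)))\<^sup>2) \<partial>M)"
      by (subst nn_integral_distr, simp, simp, subst nn_integral_density) auto
    also have "\<dots> = (\<integral>\<^sup>+x. ennreal ((cmod (m0 x))\<^sup>2) \<partial>distr M \<mu> (\<lambda>z. z 0))"
      by (subst nn_integral_distr) auto
    also have "\<dots> = (\<integral>\<^sup>+x. 1 * transfer (\<lambda>_. 1) x \<partial>\<mu>)"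
      unfolding distr_coord_0 by (subst nn_integral_transfer) auto
    also have "\<dots> = 1" using emeasure_space_1 by (simp add: transfer_one)
    finally show ?thesis by simp
  qed
  show "range (\<lambda>_::nat. sol r) \<subseteq> cylinders"
    unfolding cylinders_def by (auto intro!: exI[of _ "\<lambda>_. UNIV"])
  show "(\<Union>i::nat. sol r) = sol r" by simp
  show "emeasure (distr (density M (\<lambda>z. ennreal ((cmod (m0 (z 0)))\<^sup>2))) M (r_inf r)) (sol r) \<noteq> \<infinity>" for i :: nat
    by (rule D)
qed

lemma nn_integral_r_inf:
  assumes [measurable]: "f \<in> borel_measurable M"
  shows "(\<integral>\<^sup>+z. ennreal ((cmod (m0 (z 0)))\<^sup>2) * f (r_inf r z) \<partial>M) = (\<integral>\<^sup>+z. f z \<partial>M)"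
proof -
  have "(\<integral>\<^sup>+z. f z \<partial>M) = (\<integral>\<^sup>+z. f z \<partial>distr (density M (\<lambda>z. ennreal ((cmod (m0 (z 0)))\<^sup>2))) M (r_inf r))"
    unfolding distr_r_inf ..
  also have "\<dots> = (\<integral>\<^sup>+z. ennreal ((cmod (m0 (z 0)))\<^sup>2) * f (r_inf r z) \<partial>M)"
    by (subst nn_integral_distr, simp, simp, subst nn_integral_density) auto
  finally show ?thesis ..
qed

section \<open>Integer powers of the shift, two-sided orbits and the cocycle of weights\<close>

abbreviation T :: "int \<Rightarrow> (nat \<Rightarrow> 'a) \<Rightarrow> (nat \<Rightarrow> 'a)" where
  "T \<equiv> r_inf_pow r"

lemma T_0 [simp]: "T 0 z = z"
  by (simp add: r_inf_pow_def)

lemma T_sol: "z \<in> sol r \<Longrightarrow> T n z \<in> sol r"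
proof -
  assume z: "z \<in> sol r"
  have "(r_inf r ^^ k) z \<in> sol r" "(lshift ^^ k) z \<in> sol r" for k
    using z by (induction k) (auto simp: r_inf_sol lshift_sol)
  then show ?thesis by (simp add: r_inf_pow_def)
qed

lemma T_add_1: "z \<in> sol r \<Longrightarrow> T (n + 1) z = r_inf r (T n z)"
proof -
  assume z: "z \<in> sol r"
  consider "n \<ge> 0" | "n < 0" by linarith
  then show ?thesis
  proof cases
    case 1
    then show ?thesis by (simp add: r_inf_pow_def nat_add_distrib)
  next
    case 2
    define k where "k = nat (- n) - 1"
    have k: "nat (- n) = Suc k" "nat (- (n + 1)) = k" using 2 by (auto simp: k_def)
    have "(lshift ^^ k) z \<in> sol r" using z by (induction k) (auto simp: lshift_sol)
    then have "r_inf r (T n z) = (lshift ^^ k) z"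
      using 2 k by (simp add: r_inf_pow_def r_inf_lshift)
    moreover have "T (n + 1) z = (lshift ^^ k) z"
    proof (cases "n = -1")
      case True
      then show ?thesis by (simp add: k_def)
    next
      case False
      then show ?thesis using 2 k(2) by (simp add: r_inf_pow_def)
    qed
    ultimately show ?thesis by simp
  qed
qed

lemma T_diff_1: "z \<in> sol r \<Longrightarrow> T (n - 1) z = lshift (T n z)"
  using T_add_1[of z "n - 1"] by (simp add: lshift_r_inf)

lemma T_1: "T 1 z = r_inf r z"
  by (simp add: r_inf_pow_def)

lemma T_add: "z \<in> sol r \<Longrightarrow> T n (T m z) = T (n + m) z"
proof (induction n rule: int_induct[of _ 0])
  case (step1 n)
  then have "T (n + 1) (T m z) = r_inf r (T (n + m) z)" by (simp add: T_add_1 T_sol)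
  also have "\<dots> = T (n + m + 1) z" using step1 by (simp add: T_add_1)
  finally show ?case by (simp add: algebra_simps)
next
  case (step2 n)
  then have "T (n - 1) (T m z) = lshift (T (n + m) z)" by (simp add: T_diff_1 T_sol)
  also have "\<dots> = T (n + m - 1) z" using step2 by (simp add: T_diff_1)
  finally show ?case by (simp add: algebra_simps)
qed simp

lemma T_measurable [measurable]: "T n \<in> measurable M M"
proof (cases "n \<ge> 0")
  case True
  have "(r_inf r ^^ k) \<in> measurable M M" for k
    by (induction k) (auto intro: measurable_comp simp: id_def)
  with True show ?thesis by (simp add: r_inf_pow_def)
next
  case False
  have "(lshift ^^ k) \<in> measurable M M" for k
    by (induction k) (auto intro: measurable_comp simp: id_def)
  with False show ?thesis by (simp add: r_inf_pow_def)
qed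

definition orbit :: "int \<Rightarrow> (nat \<Rightarrow> 'a) \<Rightarrow> 'a" where
  "orbit n z = theta0 (T n z)"

lemma orbit_measurable [measurable]: "orbit n \<in> borel_measurable M"
  unfolding orbit_def[abs_def] theta0_def using measurable_compose[OF T_measurable coord_measurable] .

lemma orbit_T: "z \<in> sol r \<Longrightarrow> orbit n (T m z) = orbit (n + m) z"
  by (simp add: orbit_def T_add)

lemma orbit_Suc: "z \<in> sol r \<Longrightarrow> orbit (n + 1) z = r (orbit n z)"
  by (simp add: orbit_def T_add_1 theta0_def r_inf_def)

lemma orbit_nonneg: "z \<in> sol r \<Longrightarrow> orbit (int n) z = (r ^^ n) (z 0)"
proof (induction n)
  case (Suc n)
  then show ?case using orbit_Suc[of z "int n"] by (simp add: add.commute)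
qed (simp add: orbit_def theta0_def)

lemma orbit_nonpos: "orbit (- int n) z = z n"
proof -
  have "(lshift ^^ k) z j = z (j + k)" for k j
    by (induction k arbitrary: j) (auto simp: lshift_def)
  then show ?thesis by (cases "n = 0") (simp_all add: orbit_def theta0_def r_inf_pow_def)
qed

text \<open>Invariant under every \<open>T n\<close>, so the cocycle identities, which divide by
  values of \<open>m0\<close>, hold on it at all times together.\<close>

definition good :: "(nat \<Rightarrow> 'a) set" where
  "good = {z \<in> sol r. \<forall>n. m0 (orbit n z) \<noteq> 0}"

lemma good_sol: "z \<in> good \<Longrightarrow> z \<in> sol r"
  by (simp add: good_def)

lemma good_sets [measurable]: "good \<in> sets M"
proof -
  have "{z \<in> space M. \<forall>n. m0 (orbit n z) \<noteq> 0} \<in> sets M" by measurable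
  then show ?thesis by (simp add: good_def)
qed

lemma good_T: "z \<in> good \<Longrightarrow> T n z \<in> good"
  by (simp add: good_def T_sol orbit_T)

text \<open>Backward in time a zero of \<open>m0\<close> has \<open>W = 0\<close>, so the chain does
  not step onto it. Forward in time, and at time 0, the zeros are \<mu>-null and \<open>r\<close>
  preserves \<mu>.\<close>

lemma AE_good: "AE z in M. z \<in> good"
proof -
  have "AE z in M. m0 (z k) \<noteq> 0" for k
  proof -
    define A where "A j = (if j = k then {x. m0 x = 0} else UNIV)" for j
    have [measurable]: "A j \<in> sets borel" for j by (simp add: A_def)
    have "(\<integral>\<^sup>+x. cyl_weight k (\<lambda>k. indicator (A k)) x \<partial>\<mu>) = 0"
    proof (cases k)
      case 0
      have "(\<integral>\<^sup>+x. indicator {x. m0 x = 0} x \<partial>\<mu>) = (\<integral>\<^sup>+x. 0 \<partial>\<mu>)"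
        by (rule nn_integral_cong_AE) (use m0_nonzero in eventually_elim, auto)
      then show ?thesis using 0 by (simp add: A_def)
    next
      case (Suc j)
      have "(\<lambda>x. indicator (A j) x * transfer (indicator (A (Suc j))) x) = (\<lambda>_. 0)"
        using Suc by (auto simp: A_def transfer_def indicator_def W_def intro!: sum.neutral)
      then have "cyl_weight (Suc j) (\<lambda>k. indicator (A k)) = (\<lambda>_. 0)"
        unfolding cyl_weight_Suc_last by (intro cyl_weight_eq_0[of j]) auto
      then show ?thesis using Suc by simp
    qed
    then have "emeasure M {z \<in> sol r. \<forall>j\<le>k. z j \<in> A j} = 0"
      using emeasure_cylinder[of A k] by simp
    then have "{z \<in> sol r. \<forall>j\<le>k. z j \<in> A j} \<in> null_sets M"
      by (rule null_setsI[OF _ cylinder_sets]) simp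
    then have "AE z in M. z \<notin> {z \<in> sol r. \<forall>j\<le>k. z j \<in> A j}" by (rule AE_not_in)
    moreover have "AE z in M. z \<in> sol r" by (rule AE_I2) simp
    ultimately show ?thesis
    proof eventually_elim
      case (elim z)
      show ?case
      proof
        assume "m0 (z k) = 0"
        then have "z j \<in> A j" for j by (simp add: A_def)
        with elim show False by simp
      qed
    qed
  qed
  then have "AE z in M. \<forall>k. m0 (z k) \<noteq> 0" by (simp add: AE_all_countable)
  moreover have "AE z in M. \<forall>k. m0 ((r ^^ k) (z 0)) \<noteq> 0"
    using AE_coord_0[OF AE_comp_r_funpow[OF m0_nonzero]] .
  moreover have "AE z in M. z \<in> sol r" by (rule AE_I2) simp
  ultimately show ?thesis
  proof eventually_elim
    case (elim z)
    have "m0 (orbit n z) \<noteq> 0" for n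
      using elim by (cases n rule: int_cases2) (auto simp: orbit_nonneg orbit_nonpos)
    with elim show ?case by (simp add: good_def)
  qed
qed

lemma mtilde_0 [simp]: "mtilde r m0 0 z = 1"
  by (simp add: mtilde_def)

lemma mtilde_add_1:
  assumes "z \<in> good" shows "mtilde r m0 (n + 1) z = mtilde r m0 n z * m0 (orbit n z)"
proof (cases "n \<ge> 0")
  case True
  have "{0..<n + 1} = insert n {0..<n}" using True by auto
  then show ?thesis using True by (simp add: mtilde_def orbit_def)
next
  case False
  have "{n..-1} = insert n {n + 1..-1}" using False by auto
  then have p: "(\<Prod>k\<in>{n..-1}. m0 (orbit k z)) = m0 (orbit n z) * (\<Prod>k\<in>{n + 1..-1}. m0 (orbit k z))" by simp
  have "m0 (orbit n z) \<noteq> 0" using assms by (simp add: good_def)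
  \<comment> \<open>At \<open>n = -1\<close> the definition of \<open>mtilde\<close> changes branch,
    and the new value is the empty product.\<close>
  with p False show ?thesis
    by (cases "n = -1") (auto simp: mtilde_def orbit_def[symmetric])
qed

lemma mtilde_nonzero: "z \<in> good \<Longrightarrow> mtilde r m0 n z \<noteq> 0"
  by (auto simp: mtilde_def good_def orbit_def[symmetric])

lemma mtilde_measurable [measurable]: "mtilde r m0 n \<in> borel_measurable M"
proof -
  have [measurable]: "(\<lambda>z. m0 (theta0 (T k z))) \<in> borel_measurable M" for k
    unfolding orbit_def[symmetric] by measurable
  show ?thesis
    by (cases "n \<ge> 0") (auto simp: mtilde_def[abs_def])
qed

text \<open>At once the weight in the norm of \<open>H_z\<close> and the Radon-Nikodym factor of
  \<open>T n\<close>; this coincidence makes sampling along orbits isometric.\<close>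

definition weight :: "int \<Rightarrow> (nat \<Rightarrow> 'a) \<Rightarrow> real" where
  "weight n z = (cmod (mtilde r m0 n z))\<^sup>2"

lemma weight_measurable [measurable]: "weight n \<in> borel_measurable M"
  unfolding weight_def[abs_def] by measurable

lemma weight_0 [simp]: "weight 0 z = 1" by (simp add: weight_def)

lemma weight_pos: "z \<in> good \<Longrightarrow> 0 < weight n z"
  by (simp add: weight_def mtilde_nonzero)

lemma weight_nonneg: "0 \<le> weight n z"
  by (simp add: weight_def)

lemma weight_add_1: "z \<in> good \<Longrightarrow> weight (n + 1) z = weight n z * (cmod (m0 (orbit n z)))\<^sup>2"
  by (simp add: weight_def mtilde_add_1 norm_mult power_mult_distrib)

lemma weight_cocycle: "z \<in> good \<Longrightarrow> weight (n + m) z = weight n z * weight m (T n z)"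
proof (induction m rule: int_induct[of _ 0])
  case (step1 m)
  have "weight (n + (m + 1)) z = weight (n + m) z * (cmod (m0 (orbit (n + m) z)))\<^sup>2"
    using weight_add_1[OF step1(3), of "n + m"] by (simp add: add.assoc)
  also have "orbit (n + m) z = orbit m (T n z)"
    using step1 by (simp add: orbit_T good_sol add.commute)
  finally show ?case using step1 by (simp add: weight_add_1 good_T)
next
  case (step2 m)
  have "weight (n + m) z = weight (n + (m - 1)) z * (cmod (m0 (orbit (n + m - 1) z)))\<^sup>2"
    using weight_add_1[OF step2(3), of "n + m - 1"] by (simp add: algebra_simps)
  moreover have "weight m (T n z) = weight (m - 1) (T n z) * (cmod (m0 (orbit (n + m - 1) z)))\<^sup>2"
    using weight_add_1[OF good_T[OF step2(3)], of "m - 1" n] step2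
    by (simp add: orbit_T good_sol algebra_simps)
  moreover have "m0 (orbit (n + m - 1) z) \<noteq> 0" using step2 by (simp add: good_def)
  ultimately show ?case using step2 by simp
qed simp

lemma weight_inverse: "z \<in> good \<Longrightarrow> weight n z * weight (- n) (T n z) = 1"
  using weight_cocycle[of z n "- n"] by simp

lemma nn_integral_T:
  assumes [measurable]: "f \<in> borel_measurable M"
  shows "(\<integral>\<^sup>+z. ennreal (weight n z) * f (T n z) \<partial>M) = (\<integral>\<^sup>+z. f z \<partial>M)"
  using assms
proof (induction n arbitrary: f rule: int_induct[of _ 0])
  case (step1 n)
  note [measurable] = step1.prems
  have "(\<integral>\<^sup>+z. ennreal (weight (n + 1) z) * f (T (n + 1) z) \<partial>M) =
    (\<integral>\<^sup>+z. ennreal (weight n z) * (ennreal ((cmod (m0 (T n z 0)))\<^sup>2) * f (r_inf r (T n z))) \<partial>M)"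
  proof (rule nn_integral_cong_AE, use AE_good in eventually_elim)
    fix z assume z: "z \<in> good"
    show "ennreal (weight (n + 1) z) * f (T (n + 1) z) =
      ennreal (weight n z) * (ennreal ((cmod (m0 (T n z 0)))\<^sup>2) * f (r_inf r (T n z)))"
      using z by (simp add: weight_add_1 T_add_1 good_sol orbit_def theta0_def ennreal_mult' weight_nonneg mult.assoc)
  qed
  also have "\<dots> = (\<integral>\<^sup>+z. ennreal ((cmod (m0 (z 0)))\<^sup>2) * f (r_inf r z) \<partial>M)"
    by (rule step1.IH) measurable
  also have "\<dots> = (\<integral>\<^sup>+z. f z \<partial>M)" by (rule nn_integral_r_inf) measurable
  finally show ?case .
next
  case (step2 n)
  note [measurable] = step2.prems
  \<comment> \<open>By the cocycle identity \<open>h\<close> turns the case \<open>n - 1\<close>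
    into the case \<open>n\<close>. The remaining backward step cancels against
    \<open>nn_integral_r_inf\<close>, because the factors \<open>|m0|^2\<close> and
    \<open>weight (- 1)\<close> are reciprocal.\<close>
  define h where "h z = ennreal (weight (- 1) z) * f (lshift z)" for z
  have [measurable]: "h \<in> borel_measurable M" unfolding h_def[abs_def] by measurable
  have "(\<integral>\<^sup>+z. ennreal (weight (n - 1) z) * f (T (n - 1) z) \<partial>M) = (\<integral>\<^sup>+z. ennreal (weight n z) * h (T n z) \<partial>M)"
  proof (rule nn_integral_cong_AE, use AE_good in eventually_elim)
    fix z assume z: "z \<in> good"
    have "weight (n - 1) z = weight n z * weight (- 1) (T n z)" using weight_cocycle[OF z, of n "- 1"] by simp
    then show "ennreal (weight (n - 1) z) * f (T (n - 1) z) = ennreal (weight n z) * h (T n z)"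
      using z by (simp add: h_def T_diff_1 good_sol ennreal_mult' weight_nonneg mult.assoc)
  qed
  also have "\<dots> = (\<integral>\<^sup>+z. h z \<partial>M)" by (rule step2.IH) measurable
  also have "\<dots> = (\<integral>\<^sup>+z. ennreal ((cmod (m0 (z 0)))\<^sup>2) * h (r_inf r z) \<partial>M)"
    by (rule nn_integral_r_inf[symmetric]) measurable
  also have "\<dots> = (\<integral>\<^sup>+z. f z \<partial>M)"
  proof (rule nn_integral_cong_AE, use AE_good in eventually_elim)
    fix z assume z: "z \<in> good"
    have "weight 1 z = (cmod (m0 (z 0)))\<^sup>2" using weight_add_1[OF z, of 0] by (simp add: orbit_def theta0_def)
    then have "(cmod (m0 (z 0)))\<^sup>2 * weight (- 1) (r_inf r z) = 1"
      using weight_inverse[OF z, of 1] by (simp add: T_1)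
    then show "ennreal ((cmod (m0 (z 0)))\<^sup>2) * h (r_inf r z) = f z"
      by (simp add: h_def lshift_r_inf mult.assoc[symmetric] ennreal_mult'[symmetric])
  qed
  finally show ?case .
qed simp

lemma nn_integral_comp_T:
  assumes [measurable]: "f \<in> borel_measurable M"
  shows "(\<integral>\<^sup>+z. f (T n z) \<partial>M) = (\<integral>\<^sup>+z. ennreal (weight (- n) z) * f z \<partial>M)"
proof -
  have "(\<integral>\<^sup>+z. f (T n z) \<partial>M) = (\<integral>\<^sup>+z. ennreal (weight (- n) z) * f (T n (T (- n) z)) \<partial>M)"
    by (rule nn_integral_T[symmetric]) measurable
  also have "\<dots> = (\<integral>\<^sup>+z. ennreal (weight (- n) z) * f z \<partial>M)"
    by (intro nn_integral_cong) (simp add: T_add)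
  finally show ?thesis .
qed

text \<open>The image of \<open>M\<close> under \<open>T n\<close> has density
  \<open>weight (- n)\<close>, so null sets pull back to null sets.\<close>

lemma AE_comp_T:
  assumes "AE z in M. P z" shows "AE z in M. P (T n z)"
proof -
  obtain N where N: "{z \<in> space M. \<not> P z} \<subseteq> N" "emeasure M N = 0" and [measurable]: "N \<in> sets M"
    using assms by (rule AE_E)
  have "AE z in M. z \<notin> N" by (rule AE_not_in[OF null_setsI]) (simp_all add: N)
  then have "(\<integral>\<^sup>+z. ennreal (weight (- n) z) * indicator N z \<partial>M) = (\<integral>\<^sup>+z. 0 \<partial>M)"
    by (intro nn_integral_cong_AE) (erule eventually_mono, simp)
  then have "(\<integral>\<^sup>+z. indicator N (T n z) \<partial>M) = 0"
    using nn_integral_comp_T[of "indicator N" n] by simp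
  then have "AE z in M. indicator N (T n z) = (0 :: ennreal)"
    by (subst (asm) nn_integral_0_iff_AE) simp_all
  moreover have "AE z in M. T n z \<in> sol r" by (rule AE_I2) (simp add: T_sol)
  ultimately show ?thesis
    by eventually_elim (use N(1) in \<open>auto simp: indicator_eq_0_iff subset_iff\<close>)
qed

end

section \<open>The fundamental domain\<close>

lemma funpow_fixed: "f x = x \<Longrightarrow> (f ^^ k) x = x"
  by (induction k) simp_all

locale wavelet_system = solenoid_system \<mu> r m0 M
  for \<mu> :: "'a::metric_space measure" and r m0 M +
  assumes ergodic_r: "ergodic r \<mu>"
    and m0_not_unimodular: "\<not> (AE x in \<mu>. cmod (m0 x) = 1)"
    and log_integrable: "integrable \<mu> (\<lambda>x. ln ((cmod (m0 x))\<^sup>2))"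
begin

lemma integral_log_neg: "(\<integral>x. ln ((cmod (m0 x))\<^sup>2) \<partial>\<mu>) < 0"
proof (rule ccontr)
  assume n: "\<not> (\<integral>x. ln ((cmod (m0 x))\<^sup>2) \<partial>\<mu>) < 0"
  have nn: "(\<integral>\<^sup>+x. ennreal ((cmod (m0 x))\<^sup>2) \<partial>\<mu>) = 1"
    using nn_integral_transfer[of "\<lambda>_. 1" "\<lambda>_. 1"] emeasure_space_1 by (simp add: transfer_one)
  have int: "integrable \<mu> (\<lambda>x. (cmod (m0 x))\<^sup>2)"
    by (rule integrableI_nonneg) (simp_all add: nn)
  have "ennreal (\<integral>x. (cmod (m0 x))\<^sup>2 \<partial>\<mu>) = 1"
    using nn_integral_eq_integral[OF int] nn by simp
  then have one: "(\<integral>x. (cmod (m0 x))\<^sup>2 \<partial>\<mu>) = 1"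
    by simp
  \<comment> \<open>With \<open>t = |m0|^2\<close> of integral 1, the function
    \<open>t - 1 - ln t\<close> is nonnegative and integrates to minus the logarithmic integral. If
    that integral were not negative, \<open>h\<close> would vanish almost everywhere, which forces
    \<open>t = 1\<close>.\<close>
  define h where "h x = (cmod (m0 x))\<^sup>2 - 1 - ln ((cmod (m0 x))\<^sup>2)" for x
  have h_int: "integrable \<mu> h"
    unfolding h_def[abs_def] using int log_integrable by simp
  have h_nonneg: "AE x in \<mu>. 0 \<le> h x"
    using m0_nonzero
  proof eventually_elim
    case (elim x)
    then show ?case using ln_le_minus_one[of "(cmod (m0 x))\<^sup>2"] by (simp add: h_def)
  qed
  have "(\<integral>x. h x \<partial>\<mu>) = 1 - 1 - (\<integral>x. ln ((cmod (m0 x))\<^sup>2) \<partial>\<mu>)"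
    unfolding h_def using int log_integrable prob_space by (simp add: one)
  then have "(\<integral>x. h x \<partial>\<mu>) = 0"
    using n integral_nonneg_AE[OF h_nonneg] by simp
  then have "AE x in \<mu>. h x = 0"
    using integral_nonneg_eq_0_iff_AE[OF h_int h_nonneg] by simp
  then have "AE x in \<mu>. cmod (m0 x) = 1"
    using m0_nonzero
  proof eventually_elim
    case (elim x)
    then have "(cmod (m0 x))\<^sup>2 = 1"
      by (intro ln_eq_minus_one) (auto simp: h_def)
    then show ?case using power2_eq_imp_eq[of "cmod (m0 x)" 1] by simp
  qed
  then show False using m0_not_unimodular by simp
qed

lemma weight_int_eq_exp:
  assumes "z \<in> good"
  shows "weight (int n) z = exp (\<Sum>k<n. ln ((cmod (m0 ((r ^^ k) (z 0))))\<^sup>2))"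
proof (induction n)
  case (Suc n)
  have "m0 (orbit (int n) z) \<noteq> 0" using assms by (simp add: good_def)
  moreover have "weight (int (Suc n)) z = weight (int n) z * (cmod (m0 (orbit (int n) z)))\<^sup>2"
    using weight_add_1[OF assms, of "int n"] by (simp add: add.commute)
  ultimately show ?case
    using assms Suc by (simp add: orbit_nonneg good_sol exp_add)
qed simp

lemma AE_weight_tendsto_0: "AE z in M. (\<lambda>n. weight (int n) z) \<longlonglongrightarrow> 0"
proof -
  have "AE z in M. filterlim (\<lambda>n. \<Sum>k<n. ln ((cmod (m0 ((r ^^ k) (z 0))))\<^sup>2)) at_bot sequentially"
    by (rule AE_coord_0) (rule ergodic_sums_tendsto_at_bot[OF ergodic_r log_integrable integral_log_neg])
  then show ?thesis using AE_good
  proof eventually_elim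
    case (elim z)
    then show ?case
      unfolding weight_int_eq_exp[OF elim(2)] by (intro filterlim_compose[OF exp_at_bot])
  qed
qed

text \<open>The times at which an orbit visits \<open>peaks\<close> form a nonempty set because the weights tend to 0;
  it is almost never unbounded to the left, because passing from a peak to the preceding
  one strictly increases measure.\<close>

definition peaks :: "(nat \<Rightarrow> 'a) set" where
  "peaks = {z \<in> good. \<forall>n. weight (int (Suc n)) z < 1}"

lemma peaks_good: "z \<in> peaks \<Longrightarrow> z \<in> good"
  by (simp add: peaks_def)

lemma peaks_sets [measurable]: "peaks \<in> sets M"
proof -
  have "{z \<in> space M. z \<in> good \<and> (\<forall>n. weight (int (Suc n)) z < 1)} \<in> sets M" by measurable
  also have "{z \<in> space M. z \<in> good \<and> (\<forall>n. weight (int (Suc n)) z < 1)} = peaks"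
    by (auto simp: peaks_def good_sol)
  finally show ?thesis .
qed

lemma AE_hits_peaks: "AE z in M. \<exists>n. T (int n) z \<in> peaks"
  using AE_weight_tendsto_0 AE_good
proof eventually_elim
  case (elim z)
  have "eventually (\<lambda>n. weight (int n) z < 1) sequentially"
    using elim(1) by (rule order_tendstoD) simp
  then obtain N where N: "\<And>n. n \<ge> N \<Longrightarrow> weight (int n) z < 1"
    by (auto simp: eventually_sequentially)
  \<comment> \<open>The last time with weight at least 1 is a peak: a later weight is below 1 and is
    the product of that weight with the relative one, so the relative one is below 1.\<close>
  define I where "I = {n. 1 \<le> weight (int n) z}"
  have "n < N" if "n \<in> I" for n
    using N[of n] that by (cases "n < N") (auto simp: I_def)
  then have fin: "finite I" by (rule bounded_nat_set_is_finite[OF ballI])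
  have "0 \<in> I" by (simp add: I_def)
  define n where "n = Max I"
  have "n \<in> I" using Max_in[OF fin] \<open>0 \<in> I\<close> unfolding n_def by blast
  then have n: "1 \<le> weight (int n) z" by (simp add: I_def)
  have "weight (int (Suc m)) (T (int n) z) < 1" for m
  proof -
    have "n + Suc m \<notin> I" using Max_ge[OF fin, of "n + Suc m"] by (auto simp: n_def)
    then have "weight (int (n + Suc m)) z < 1" by (simp only: I_def mem_Collect_eq not_le)
    also have "int (n + Suc m) = int n + int (Suc m)" by simp
    finally have "weight (int n + int (Suc m)) z < 1" .
    then have "weight (int n) z * weight (int (Suc m)) (T (int n) z) < 1"
      using weight_cocycle[OF elim(2)] by simp
    then show ?thesis
      using n mult_mono[of 1 "weight (int n) z" 1 "weight (int (Suc m)) (T (int n) z)"] by (auto simp: not_less[symmetric])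
  qed
  then show ?case using elim(2) by (auto simp: peaks_def good_T)
qed

section \<open>Peaks do not recur indefinitely to the left\<close>

definition left_recurrent :: "(nat \<Rightarrow> 'a) set" where
  "left_recurrent = {z \<in> peaks. \<forall>N. \<exists>n\<ge>N. T (- int n) z \<in> peaks}"

text \<open>The preceding peak lies \<open>n\<close> steps to the left. At \<open>n = 0\<close> the
  condition carries no information, whence \<open>Suc n\<close> wherever return times are
  summed.\<close>

definition first_return :: "nat \<Rightarrow> (nat \<Rightarrow> 'a) set" where
  "first_return n = {z \<in> left_recurrent. T (- int n) z \<in> peaks \<and> (\<forall>k. 0 < k \<longrightarrow> k < n \<longrightarrow> T (- int k) z \<notin> peaks)}"

lemma left_recurrent_sets [measurable]: "left_recurrent \<in> sets M"
proof -
  have "{z \<in> space M. z \<in> peaks \<and> (\<forall>N. \<exists>n. N \<le> n \<and> T (- int n) z \<in> peaks)} \<in> sets M" by measurable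
  also have "{z \<in> space M. z \<in> peaks \<and> (\<forall>N. \<exists>n. N \<le> n \<and> T (- int n) z \<in> peaks)} = left_recurrent"
    using sets.sets_into_space[OF peaks_sets] by (auto simp: left_recurrent_def)
  finally show ?thesis .
qed

lemma first_return_sets [measurable]: "first_return n \<in> sets M"
proof -
  have "{z \<in> space M. z \<in> left_recurrent \<and> T (- int n) z \<in> peaks \<and> (\<forall>k. 0 < k \<longrightarrow> k < n \<longrightarrow> T (- int k) z \<notin> peaks)} \<in> sets M"
    by measurable
  also have "{z \<in> space M. z \<in> left_recurrent \<and> T (- int n) z \<in> peaks \<and> (\<forall>k. 0 < k \<longrightarrow> k < n \<longrightarrow> T (- int k) z \<notin> peaks)} = first_return n"
    using sets.sets_into_space[OF left_recurrent_sets] by (auto simp: first_return_def)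
  finally show ?thesis .
qed

lemma first_return_good: "z \<in> first_return n \<Longrightarrow> z \<in> good"
  by (simp add: first_return_def left_recurrent_def peaks_good)

text \<open>Seen from the preceding peak, \<open>z\<close> is a later point of relative weight below
  1, and the backward step has the reciprocal weight. This is the Jacobian bound of the return
  map.\<close>

lemma weight_gt_1_on_first_return: "z \<in> first_return (Suc n) \<Longrightarrow> 1 < weight (- int (Suc n)) z"
proof -
  assume z: "z \<in> first_return (Suc n)"
  have zg: "z \<in> good" using z by (rule first_return_good)
  have "T (- int (Suc n)) z \<in> peaks" using z by (simp add: first_return_def)
  then have lt: "weight (int (Suc n)) (T (- int (Suc n)) z) < 1" by (simp add: peaks_def)
  have p: "0 < weight (- int (Suc n)) z" by (rule weight_pos[OF zg])
  have eq: "weight (- int (Suc n)) z * weight (int (Suc n)) (T (- int (Suc n)) z) = 1"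
    using weight_inverse[OF zg, of "- int (Suc n)"] by (simp only: minus_minus)
  have "weight (- int (Suc n)) z * weight (int (Suc n)) (T (- int (Suc n)) z) < weight (- int (Suc n)) z * 1"
    by (rule mult_strict_left_mono[OF lt p])
  then show ?thesis unfolding eq by simp
qed

text \<open>The preimage consists of the landing points of the leftward return. They are peaks and
  keep the infinitely many peaks further left.\<close>

lemma vimage_first_return_subset: "T (int (Suc n)) -` first_return (Suc n) \<inter> sol r \<subseteq> left_recurrent"
proof
  fix z assume "z \<in> T (int (Suc n)) -` first_return (Suc n) \<inter> sol r"
  then have sol: "z \<in> sol r" and c: "T (int (Suc n)) z \<in> first_return (Suc n)" by auto
  have "T (- int (Suc n)) (T (int (Suc n)) z) \<in> peaks" using c by (simp add: first_return_def)
  then have zG: "z \<in> peaks" using sol by (simp add: T_add)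
  have "\<exists>m\<ge>N. T (- int m) z \<in> peaks" for N
  proof -
    obtain m where m: "m \<ge> N + Suc n" "T (- int m) (T (int (Suc n)) z) \<in> peaks"
      using c unfolding first_return_def left_recurrent_def by blast
    have "- int m + int (Suc n) = - int (m - Suc n)" using m(1) by simp
    then have "T (- int (m - Suc n)) z \<in> peaks" using m(2) sol by (simp only: T_add)
    moreover have "m - Suc n \<ge> N" using m(1) by simp
    ultimately show ?thesis by blast
  qed
  with zG show "z \<in> left_recurrent" by (simp add: left_recurrent_def)
qed

text \<open>Injectivity of the return map: if one point were reached from two distances, the nearer
  start would be a peak strictly between it and the farther start.\<close>

lemma disjoint_vimage_first_return: "disjoint_family (\<lambda>n. T (int (Suc n)) -` first_return (Suc n) \<inter> sol r)"
proof -
  have False if z: "z \<in> sol r" and n: "T (int (Suc n)) z \<in> first_return (Suc n)" and m: "T (int (Suc m)) z \<in> first_return (Suc m)"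
    and "n < m" for z n m
  proof -
    have "0 < m - n" "m - n < Suc m" using \<open>n < m\<close> by auto
    then have "T (- int (m - n)) (T (int (Suc m)) z) \<notin> peaks"
      using m unfolding first_return_def by blast
    moreover have "- int (m - n) + int (Suc m) = int (Suc n)" using \<open>n < m\<close> by simp
    ultimately have "T (int (Suc n)) z \<notin> peaks" using z by (simp only: T_add simp_thms)
    then show False using n by (simp add: first_return_def left_recurrent_def)
  qed
  note less = this
  show ?thesis
    unfolding disjoint_family_on_def
  proof (intro ballI impI equals0I)
    fix n m z
    assume "n \<noteq> m" and z: "z \<in> (T (int (Suc n)) -` first_return (Suc n) \<inter> sol r) \<inter> (T (int (Suc m)) -` first_return (Suc m) \<inter> sol r)"
    then consider "n < m" | "m < n" by linarith
    then show False using z less[of z n m] less[of z m n] by cases blast+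
  qed
qed

lemma left_recurrent_covered: "z \<in> left_recurrent \<Longrightarrow> \<exists>n. z \<in> first_return (Suc n)"
proof -
  assume z: "z \<in> left_recurrent"
  then obtain n where n: "n \<ge> Suc 0" "T (- int n) z \<in> peaks" unfolding left_recurrent_def by blast
  define k where "k = (LEAST n. n \<ge> Suc 0 \<and> T (- int n) z \<in> peaks)"
  have k: "k \<ge> Suc 0 \<and> T (- int k) z \<in> peaks"
    unfolding k_def by (rule LeastI[of _ n]) (use n in simp)
  have "T (- int j) z \<notin> peaks" if "0 < j" "j < k" for j
    using not_less_Least[of j "\<lambda>n. n \<ge> Suc 0 \<and> T (- int n) z \<in> peaks"] that unfolding k_def by auto
  then have "z \<in> first_return k" using z k by (simp add: first_return_def)
  with k show ?thesis by (cases k) auto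
qed

text \<open>The landing sets are disjoint subsets of \<open>left_recurrent\<close>, and their total
  measure is the integral of the Jacobian \<open>h\<close>, which exceeds 1 throughout
  \<open>left_recurrent\<close>.\<close>

lemma AE_not_left_recurrent: "AE z in M. z \<notin> left_recurrent"
proof -
  define h where "h z = (\<Sum>n. ennreal (weight (- int (Suc n)) z) * indicator (first_return (Suc n)) z)" for z
  have [measurable]: "h \<in> borel_measurable M" unfolding h_def[abs_def] by measurable
  have B [measurable]: "T (int (Suc n)) -` first_return (Suc n) \<inter> sol r \<in> sets M" for n
    using measurable_sets[OF T_measurable first_return_sets, of "int (Suc n)" "Suc n"] by simp
  have B_eq: "(\<integral>\<^sup>+z. ennreal (weight (- int (Suc n)) z) * indicator (first_return (Suc n)) z \<partial>M) =
      emeasure M (T (int (Suc n)) -` first_return (Suc n) \<inter> sol r)" for n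
  proof -
    have "(\<integral>\<^sup>+z. ennreal (weight (- int (Suc n)) z) * indicator (first_return (Suc n)) z \<partial>M) =
        (\<integral>\<^sup>+z. indicator (first_return (Suc n)) (T (int (Suc n)) z) \<partial>M)"
      by (rule nn_integral_comp_T[symmetric]) measurable
    also have "\<dots> = (\<integral>\<^sup>+z. indicator (T (int (Suc n)) -` first_return (Suc n) \<inter> sol r) z \<partial>M)"
      by (rule nn_integral_cong) (simp add: indicator_def)
    finally show ?thesis by (simp only: nn_integral_indicator[OF B])
  qed
  have "(\<integral>\<^sup>+z. h z \<partial>M) = (\<Sum>n. emeasure M (T (int (Suc n)) -` first_return (Suc n) \<inter> sol r))"
    unfolding h_def B_eq[symmetric] by (rule nn_integral_suminf) measurable
  also have "\<dots> = emeasure M (\<Union>n. T (int (Suc n)) -` first_return (Suc n) \<inter> sol r)"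
    by (rule suminf_emeasure[OF _ disjoint_vimage_first_return]) (use B in blast)
  also have "\<dots> \<le> emeasure M left_recurrent"
    using vimage_first_return_subset by (intro emeasure_mono) auto
  also have "\<dots> = (\<integral>\<^sup>+z. indicator left_recurrent z \<partial>M)" by simp
  finally have le: "(\<integral>\<^sup>+z. h z \<partial>M) \<le> (\<integral>\<^sup>+z. indicator left_recurrent z \<partial>M)" .
  have gt: "1 < h z" if "z \<in> left_recurrent" for z
  proof -
    obtain n where n: "z \<in> first_return (Suc n)" using left_recurrent_covered[OF \<open>z \<in> left_recurrent\<close>] by blast
    define g where "g = (\<lambda>k. ennreal (weight (- int (Suc k)) z) * indicator (first_return (Suc k)) z)"
    have "1 < g n"
      using ennreal_lessI[OF _ weight_gt_1_on_first_return[OF n]] weight_gt_1_on_first_return[OF n] n by (simp add: g_def)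
    also have "g n = sum g {n}" by simp
    also have "\<dots> \<le> suminf g" by (rule sum_le_suminf) auto
    finally show ?thesis by (simp only: h_def g_def)
  qed
  have "AE z in M. h z \<le> indicator left_recurrent z"
  proof (rule ccontr)
    assume "\<not> (AE z in M. h z \<le> indicator left_recurrent z)"
    moreover have "AE z in M. indicator left_recurrent z \<le> h z"
      using gt by (intro AE_I2) (auto simp: indicator_def less_imp_le)
    \<comment> \<open>Finiteness of the measure enters here: it lets a strict inequality of
      integrands survive integration.\<close>
    moreover have "(\<integral>\<^sup>+z. indicator left_recurrent z \<partial>M) \<noteq> \<infinity>"
      using M.emeasure_finite[of left_recurrent] by simp
    ultimately have "(\<integral>\<^sup>+z. indicator left_recurrent z \<partial>M) < (\<integral>\<^sup>+z. h z \<partial>M)"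
      by (intro nn_integral_less) auto
    with le show False by simp
  qed
  then show ?thesis
  proof eventually_elim
    case (elim z)
    then show ?case using gt[of z] by (auto simp: indicator_def)
  qed
qed

section \<open>The leftmost peak of an orbit as fundamental domain\<close>

definition fund_dom :: "(nat \<Rightarrow> 'a) set" where
  "fund_dom = {z \<in> peaks. \<forall>n. T (- int (Suc n)) z \<notin> peaks}"

lemma fund_dom_good: "z \<in> fund_dom \<Longrightarrow> z \<in> good"
  by (simp add: fund_dom_def peaks_good)

lemma fund_dom_sets [measurable]: "fund_dom \<in> sets M"
proof -
  have "{z \<in> space M. z \<in> peaks \<and> (\<forall>n. T (- int (Suc n)) z \<notin> peaks)} \<in> sets M" by measurable
  also have "{z \<in> space M. z \<in> peaks \<and> (\<forall>n. T (- int (Suc n)) z \<notin> peaks)} = fund_dom"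
    using sets.sets_into_space[OF peaks_sets] by (auto simp: fund_dom_def)
  finally show ?thesis .
qed

lemma fund_dom_unique_time:
  assumes "T n z \<in> fund_dom" "T m z \<in> fund_dom" "z \<in> sol r"
  shows "n = m"
proof -
  have False if "T n z \<in> fund_dom" "T m z \<in> fund_dom" "n < m" for n m :: int
  proof -
    have "T (- int (Suc (nat (m - n - 1)))) (T m z) \<notin> peaks" using that(2) unfolding fund_dom_def by blast
    moreover have "- int (Suc (nat (m - n - 1))) + m = n" using that(3) by simp
    ultimately have "T n z \<notin> peaks" using assms(3) by (simp only: T_add simp_thms)
    with that(1) show False by (simp add: fund_dom_def)
  qed
  with assms show ?thesis by (metis linorder_neqE)
qed

lemma AE_hits_fund_dom: "AE z in M. \<exists>n. T n z \<in> fund_dom"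
proof -
  \<comment> \<open>The peak found on the orbit is a translate of \<open>z\<close>, so all
    translates must avoid the null set; quasi-invariance grants this.\<close>
  have "AE z in M. \<forall>n. T n z \<notin> left_recurrent"
    using AE_comp_T[OF AE_not_left_recurrent] by (simp add: AE_all_countable)
  then show ?thesis using AE_hits_peaks AE_good
  proof eventually_elim
    case (elim z)
    have sol: "z \<in> sol r" using elim(3) by (rule good_sol)
    obtain n where n: "T (int n) z \<in> peaks" using elim(2) by blast
    have "T (int n) z \<notin> left_recurrent" using elim(1) by blast
    then obtain N where N: "\<And>m. m \<ge> N \<Longrightarrow> T (- int m) (T (int n) z) \<notin> peaks"
      using n unfolding left_recurrent_def by blast
    define I where "I = {m. T (- int m) (T (int n) z) \<in> peaks}"
    have "n < N" if "n \<in> I" for n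
      using N[of n] that by (cases "n < N") (auto simp: I_def)
    then have fin: "finite I" by (rule bounded_nat_set_is_finite[OF ballI])
    have "0 \<in> I" using n by (simp add: I_def)
    define m where "m = Max I"
    have mI: "m \<in> I" using Max_in[OF fin] \<open>0 \<in> I\<close> by (auto simp: m_def)
    have "T (- int (Suc k)) (T (- int m) (T (int n) z)) \<notin> peaks" for k
    proof -
      have "m + Suc k \<notin> I" using Max_ge[OF fin, of "m + Suc k"] by (auto simp: m_def)
      moreover have "- int (Suc k) + - int m = - int (m + Suc k)" by simp
      ultimately show ?thesis by (simp only: I_def mem_Collect_eq T_add[OF T_sol[OF sol]] simp_thms)
    qed
    with mI have "T (- int m) (T (int n) z) \<in> fund_dom" by (simp add: fund_dom_def I_def)
    then show ?case using sol by (auto simp: T_add)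
  qed
qed

lemma fundamental_domain_fund_dom: "fundamental_domain r M fund_dom"
  unfolding fundamental_domain_def
proof (intro conjI allI impI)
  show "AE z in M. z \<in> (\<Union>n. T n ` fund_dom)"
    using AE_hits_fund_dom AE_good
  proof eventually_elim
    case (elim z)
    then obtain n where n: "T n z \<in> fund_dom" by blast
    have "z = T (- n) (T n z)" using elim(2) by (simp add: T_add good_sol)
    with n show ?case by blast
  qed
  fix n m :: int assume "n \<noteq> m"
  have "z \<notin> T n ` fund_dom \<inter> T m ` fund_dom" for z
  proof
    assume "z \<in> T n ` fund_dom \<inter> T m ` fund_dom"
    then obtain x y where xy: "x \<in> fund_dom" "y \<in> fund_dom" "z = T n x" "z = T m y" by blast
    then have sol: "x \<in> sol r" "y \<in> sol r" by (auto intro: fund_dom_good good_sol)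
    have "T (- n) z = x" unfolding xy(3) using sol(1) by (simp add: T_add)
    then have "T (- n) z \<in> fund_dom" using xy(1) by simp
    moreover have "T (- m) z = y" unfolding xy(4) using sol(2) by (simp add: T_add)
    then have "T (- m) z \<in> fund_dom" using xy(2) by simp
    moreover have "z \<in> sol r" unfolding xy(3) using sol(1) by (rule T_sol)
    ultimately have "- n = - m" by (rule fund_dom_unique_time)
    with \<open>n \<noteq> m\<close> show False by simp
  qed
  then show "AE z in M. z \<notin> T n ` fund_dom \<inter> T m ` fund_dom" by simp
qed simp

section \<open>The decomposition and its components\<close>

definition Psi :: "((nat \<Rightarrow> 'a) \<Rightarrow> complex) \<Rightarrow> (nat \<Rightarrow> 'a) \<Rightarrow> int \<Rightarrow> complex" where
  "Psi \<xi> z n = \<xi> (T n z)"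

lemma wnorm2_eq: "wnorm2 r m0 z s = (\<integral>\<^sup>+n. ennreal (weight n z) * ennreal ((cmod (s n))\<^sup>2) \<partial>count_space UNIV)"
  by (simp add: wnorm2_def weight_def ennreal_mult' mult.commute)

text \<open>Unfolding over the orbits. Written as a function of \<open>T n z\<close>, each summand
  is an instance of \<open>nn_integral_T\<close>; after Tonelli the indicators of the translates of
  \<open>fund_dom\<close> add up to 1 almost everywhere.\<close>

lemma nn_integral_orbit_decomposition:
  assumes [measurable]: "f \<in> borel_measurable M"
  shows "(\<integral>\<^sup>+z. indicator fund_dom z * (\<integral>\<^sup>+n. ennreal (weight n z) * f (T n z) \<partial>count_space UNIV) \<partial>M) = (\<integral>\<^sup>+z. f z \<partial>M)"
proof -
  have "(\<integral>\<^sup>+z. indicator fund_dom z * (\<integral>\<^sup>+n. ennreal (weight n z) * f (T n z) \<partial>count_space UNIV) \<partial>M) =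
    (\<integral>\<^sup>+z. (\<integral>\<^sup>+n. ennreal (weight n z) * (indicator fund_dom (T (- n) (T n z)) * f (T n z)) \<partial>count_space UNIV) \<partial>M)"
  proof (rule nn_integral_cong)
    fix z assume "z \<in> space M"
    then have "T (- n) (T n z) = z" for n by (simp add: T_add)
    then show "indicator fund_dom z * (\<integral>\<^sup>+n. ennreal (weight n z) * f (T n z) \<partial>count_space UNIV) =
      (\<integral>\<^sup>+n. ennreal (weight n z) * (indicator fund_dom (T (- n) (T n z)) * f (T n z)) \<partial>count_space UNIV)"
      by (subst nn_integral_cmult[symmetric]) (simp_all add: mult_ac)
  qed
  also have "\<dots> = (\<integral>\<^sup>+n. (\<integral>\<^sup>+z. ennreal (weight n z) * (indicator fund_dom (T (- n) (T n z)) * f (T n z)) \<partial>M) \<partial>count_space UNIV)"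
    by (rule nn_integral_count_space_nn_integral) simp_all
  also have "\<dots> = (\<integral>\<^sup>+n. (\<integral>\<^sup>+z. indicator fund_dom (T (- n) z) * f z \<partial>M) \<partial>count_space UNIV)"
    using nn_integral_T[of "\<lambda>z. indicator fund_dom (T (- n) z) * f z" n for n] by simp
  also have "\<dots> = (\<integral>\<^sup>+z. (\<integral>\<^sup>+n. indicator fund_dom (T (- n) z) * f z \<partial>count_space UNIV) \<partial>M)"
    by (rule nn_integral_count_space_nn_integral[symmetric]) simp_all
  also have "\<dots> = (\<integral>\<^sup>+z. f z \<partial>M)"
  proof (rule nn_integral_cong_AE, use AE_hits_fund_dom AE_good in eventually_elim)
    fix z assume "\<exists>n. T n z \<in> fund_dom" and good: "z \<in> good"
    then obtain n where n: "T n z \<in> fund_dom" by blast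
    have "T (- k) z \<in> fund_dom \<longleftrightarrow> k = - n" for k
      using fund_dom_unique_time[OF _ n good_sol[OF good], of "- k"] n by auto
    then have "(\<integral>\<^sup>+k. indicator fund_dom (T (- k) z) * f z \<partial>count_space UNIV) =
      (\<integral>\<^sup>+k. f z * indicator {- n} k \<partial>count_space UNIV)"
      by (intro nn_integral_cong) (auto simp: indicator_def)
    also have "\<dots> = f z" by (subst nn_integral_cmult_indicator) simp_all
    finally show "(\<integral>\<^sup>+k. indicator fund_dom (T (- k) z) * f z \<partial>count_space UNIV) = f z" .
  qed
  finally show ?thesis .
qed

lemma Psi_isometry:
  assumes [measurable]: "\<xi> \<in> borel_measurable M"
  shows "(\<integral>\<^sup>+z. indicator fund_dom z * wnorm2 r m0 z (Psi \<xi> z) \<partial>M) = (\<integral>\<^sup>+z. ennreal ((cmod (\<xi> z))\<^sup>2) \<partial>M)"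
  unfolding wnorm2_eq Psi_def
  by (rule nn_integral_orbit_decomposition[of "\<lambda>z. ennreal ((cmod (\<xi> z))\<^sup>2)"]) measurable

lemma Psi_surj:
  assumes s: "s \<in> direct_integral r m0 M fund_dom"
  shows "\<exists>\<xi>\<in>L2 M. \<forall>z\<in>fund_dom. \<forall>n. Psi \<xi> z n = s z n"
proof -
  have [measurable]: "(\<lambda>z. s z n) \<in> borel_measurable M" for n
    using s by (simp add: direct_integral_def)
  \<comment> \<open>The position of \<open>y\<close> relative to the domain point of its orbit.
    Enumerating the integers through \<open>int_decode\<close> turns the search into a measurable
    \<open>LEAST\<close> over naturals; orbits missing \<open>fund_dom\<close> form a null
    set.\<close>
  define time where "time y = (LEAST k. T (- int_decode k) y \<in> fund_dom)" for y
  define \<xi> where "\<xi> y = s (T (- int_decode (time y)) y) (int_decode (time y))" for y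
  have time_eq: "int_decode (time (T n z)) = n" if z: "z \<in> fund_dom" for z n
  proof -
    have sol: "z \<in> sol r" using z by (intro good_sol fund_dom_good)
    have *: "T (- int_decode k) (T n z) \<in> fund_dom \<longleftrightarrow> int_decode k = n" for k
    proof -
      have "T (- int_decode k) (T n z) = T (n - int_decode k) z" using sol by (simp add: T_add)
      moreover have "T (n - int_decode k) z \<in> fund_dom \<longleftrightarrow> n - int_decode k = 0"
        using fund_dom_unique_time[of "n - int_decode k" z 0] z sol by auto
      ultimately show ?thesis by auto
    qed
    have "T (- int_decode (time (T n z))) (T n z) \<in> fund_dom"
      unfolding time_def by (rule LeastI[of _ "int_encode n"]) (use *[of "int_encode n"] in simp)
    then show ?thesis by (simp only: *)
  qed
  have eq: "Psi \<xi> z n = s z n" if "z \<in> fund_dom" for z n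
  proof -
    have "z \<in> sol r" using that by (intro good_sol fund_dom_good)
    then show ?thesis unfolding Psi_def \<xi>_def time_eq[OF that] by (simp add: T_add)
  qed
  have time_meas: "time \<in> measurable M (count_space UNIV)"
    unfolding time_def[abs_def] by measurable
  have [measurable]: "\<xi> \<in> borel_measurable M"
    unfolding \<xi>_def[abs_def]
  proof (rule measurable_compose_countable[OF _ time_meas])
    show "(\<lambda>x. s (T (- int_decode i) x) (int_decode i)) \<in> borel_measurable M" for i
      by (rule measurable_compose[OF T_measurable]) measurable
  qed
  have "(\<integral>\<^sup>+z. ennreal ((cmod (\<xi> z))\<^sup>2) \<partial>M) = (\<integral>\<^sup>+z. indicator fund_dom z * wnorm2 r m0 z (Psi \<xi> z) \<partial>M)"
    by (rule Psi_isometry[symmetric]) measurable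
  also have "\<dots> = (\<integral>\<^sup>+z. indicator fund_dom z * wnorm2 r m0 z (s z) \<partial>M)"
  proof (rule nn_integral_cong)
    fix z
    show "indicator fund_dom z * wnorm2 r m0 z (Psi \<xi> z) = indicator fund_dom z * wnorm2 r m0 z (s z)"
    proof (cases "z \<in> fund_dom")
      case True
      then have "Psi \<xi> z = s z" using eq by auto
      then show ?thesis by simp
    qed simp
  qed
  also have "\<dots> < \<infinity>" using s by (simp add: direct_integral_def)
  finally have "\<xi> \<in> L2 M" by (simp add: L2_def)
  with eq show ?thesis by blast
qed

lemma unitary_intertwiner_Psi: "unitary_intertwiner r m0 M fund_dom Psi"
  unfolding unitary_intertwiner_def
proof (intro conjI ballI allI impI)
  fix \<xi> assume \<xi>: "\<xi> \<in> L2 M"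
  then have [measurable]: "\<xi> \<in> borel_measurable M" by (simp add: L2_def)
  show iso: "(\<integral>\<^sup>+z. indicator fund_dom z * wnorm2 r m0 z (Psi \<xi> z) \<partial>M) = (\<integral>\<^sup>+z. ennreal ((cmod (\<xi> z))\<^sup>2) \<partial>M)"
    by (rule Psi_isometry) measurable
  have "(\<lambda>z. Psi \<xi> z n) \<in> borel_measurable M" for n
    unfolding Psi_def by measurable
  with iso \<xi> show "Psi \<xi> \<in> direct_integral r m0 M fund_dom"
    by (simp add: direct_integral_def L2_def)
  have "Psi (U_op r m0 \<xi>) z n = U_z r m0 z (Psi \<xi> z) n" if "z \<in> fund_dom" for z n
    using T_add_1[of z n] good_sol[OF fund_dom_good[OF that]] by (simp add: Psi_def U_op_def U_z_def)
  then show "AE z in M. z \<in> fund_dom \<longrightarrow> (\<forall>n. Psi (U_op r m0 \<xi>) z n = U_z r m0 z (Psi \<xi> z) n)"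
    by simp
next
  fix s assume "s \<in> direct_integral r m0 M fund_dom"
  then obtain \<xi> where "\<xi> \<in> L2 M" "\<forall>z\<in>fund_dom. \<forall>n. Psi \<xi> z n = s z n"
    using Psi_surj by blast
  then show "\<exists>\<xi>\<in>L2 M. AE z in M. z \<in> fund_dom \<longrightarrow> (\<forall>n. Psi \<xi> z n = s z n)"
    by (intro bexI[of _ \<xi>]) simp_all
qed (simp_all add: Psi_def pi_op_def pi_z_def)

text \<open>Multiplication operators isolate a single coordinate of a nonzero vector, the shift
  carries that basis vector to all others, and finite combinations are dense.\<close>

lemma irreducible_if_inj:
  assumes good: "z \<in> good" and inj: "inj (\<lambda>n. orbit n z)"
  shows "irreducible_z r m0 z"
  unfolding irreducible_z_def
proof (intro allI impI)
  fix K :: "(int \<Rightarrow> complex) set"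
  assume closed: "closed_subspace_z r m0 z K" and U: "U_z r m0 z ` K = K"
    and pi: "\<forall>f::'a \<Rightarrow> complex. f \<in> borel_measurable borel \<longrightarrow> bounded (range f) \<longrightarrow> pi_z r z f ` K \<subseteq> K"
  define e where "e n = (\<lambda>k. if k = n then 1 else 0 :: complex)" for n :: int
  have lin: "(\<lambda>n. x * \<xi> n + y * \<eta> n) \<in> K" if "\<xi> \<in> K" "\<eta> \<in> K" for \<xi> \<eta> x y
    using closed that unfolding closed_subspace_z_def by blast
  have zero: "(\<lambda>_. 0) \<in> K" using closed unfolding closed_subspace_z_def by blast
  have unscale: "\<xi> \<in> K" if "(\<lambda>n. x * \<xi> n) \<in> K" "x \<noteq> 0" for \<xi> x
    using lin[OF that(1) zero, of "1 / x" 0] that(2) by simp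
  have m0: "m0 (orbit n z) \<noteq> 0" for n using good by (simp add: good_def)
  show "K = {\<lambda>_. 0} \<or> K = H_z r m0 z"
  proof (cases "K = {\<lambda>_. 0}")
    case False
    then obtain \<xi> where \<xi>: "\<xi> \<in> K" "\<xi> \<noteq> (\<lambda>_. 0)" using zero by blast
    then obtain n where n: "\<xi> n \<noteq> 0" by auto
    have "e n \<in> K"
    proof -
      \<comment> \<open>By injectivity the orbit meets this singleton only at time \<open>n\<close>,
        so \<open>pi_z\<close> with \<open>f\<close> projects onto coordinate
        \<open>n\<close>.\<close>
      define f :: "'a \<Rightarrow> complex" where "f = indicator {orbit n z}"
      have f1: "f \<in> borel_measurable borel" unfolding f_def by measurable
      have f2: "bounded (range f)"
        by (rule boundedI[of _ 1]) (auto simp: f_def indicator_def)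
      have "pi_z r z f \<xi> \<in> K" using pi f1 f2 \<xi>(1) by blast
      moreover have "pi_z r z f \<xi> = (\<lambda>k. \<xi> n * e n k)"
      proof
        fix k
        have "f (orbit k z) = (if k = n then 1 else 0)"
          using injD[OF inj, of k n] by (auto simp: f_def indicator_def)
        then show "pi_z r z f \<xi> k = \<xi> n * e n k"
          by (simp add: pi_z_def e_def orbit_def)
      qed
      ultimately have "(\<lambda>k. \<xi> n * e n k) \<in> K" by simp
      then show ?thesis using n by (rule unscale)
    qed
    moreover have "e (k - 1) \<in> K" if "e k \<in> K" for k
    proof -
      have "U_z r m0 z (e k) \<in> K" using U that by blast
      moreover have "U_z r m0 z (e k) = (\<lambda>j. m0 (orbit (k - 1) z) * e (k - 1) j)"
        by (auto simp: U_z_def e_def orbit_def[symmetric])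
      ultimately have "(\<lambda>j. m0 (orbit (k - 1) z) * e (k - 1) j) \<in> K" by simp
      then show ?thesis using m0 by (rule unscale)
    qed
    moreover have "e (k + 1) \<in> K" if "e k \<in> K" for k
    proof -
      have "e k \<in> U_z r m0 z ` K" using U that by simp
      then obtain \<eta> where \<eta>: "\<eta> \<in> K" "e k = U_z r m0 z \<eta>" by blast
      have "e k j = m0 (orbit j z) * \<eta> (j + 1)" for j
        using \<eta>(2) by (simp add: U_z_def orbit_def)
      from this[of "j - 1" for j] have "e k (j - 1) = m0 (orbit (j - 1) z) * \<eta> j" for j by simp
      then have "\<eta> j = e k (j - 1) / m0 (orbit (j - 1) z)" for j using m0 by simp
      then have "\<eta> = (\<lambda>j. (1 / m0 (orbit k z)) * e (k + 1) j)" by (auto simp: e_def)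
      with \<eta>(1) have "(\<lambda>j. (1 / m0 (orbit k z)) * e (k + 1) j) \<in> K" by simp
      then show ?thesis by (rule unscale) (use m0 in simp)
    qed
    ultimately have e: "e k \<in> K" for k
      by (induction k rule: int_induct[of _ n]) auto
    have trunc: "(\<lambda>k. if k \<in> S then \<eta> k else 0) \<in> K" if "finite S" for S \<eta>
      using that
    proof induction
      case (insert k S)
      then have "(\<lambda>j. 1 * (if j \<in> S then \<eta> j else 0) + \<eta> k * e k j) \<in> K"
        by (intro lin e) auto
      also have "(\<lambda>j. 1 * (if j \<in> S then \<eta> j else 0) + \<eta> k * e k j) = (\<lambda>j. if j \<in> insert k S then \<eta> j else 0)"
        using insert.hyps by (auto simp: e_def)
      finally show ?case .
    qed (simp add: zero)
    have "H_z r m0 z \<subseteq> K"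
    proof
      fix \<eta> assume \<eta>: "\<eta> \<in> H_z r m0 z"
      define s where "s k = (\<lambda>n. if n \<in> {- int k..int k} then \<eta> n else 0)" for k
      \<comment> \<open>Dominated convergence for counting measure: at each index the error vanishes
        from some truncation on, and the summand of the norm of \<open>\<eta>\<close>
        dominates.\<close>
      have "(\<lambda>k. wnorm2 r m0 z (\<lambda>n. s k n - \<eta> n)) \<longlonglongrightarrow> (\<integral>\<^sup>+n. 0 \<partial>count_space (UNIV :: int set))"
        unfolding wnorm2_eq
      proof (rule nn_integral_dominated_convergence)
        let ?h = "\<lambda>n. ennreal (weight n z) * ennreal ((cmod (\<eta> n))\<^sup>2)"
        show "(\<integral>\<^sup>+n. ?h n \<partial>count_space UNIV) < \<infinity>"
          using \<eta> by (simp add: H_z_def wnorm2_eq)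
        show "AE n in count_space UNIV. ennreal (weight n z) * ennreal ((cmod (s k n - \<eta> n))\<^sup>2) \<le> ?h n" for k
          by (intro AE_I2) (auto simp: s_def)
        show "AE n in count_space UNIV. (\<lambda>k. ennreal (weight n z) * ennreal ((cmod (s k n - \<eta> n))\<^sup>2)) \<longlonglongrightarrow> 0"
        proof (rule AE_I2)
          fix n
          have "eventually (\<lambda>k. ennreal (weight n z) * ennreal ((cmod (s k n - \<eta> n))\<^sup>2) = 0) sequentially"
            by (rule eventually_sequentiallyI[of "nat \<bar>n\<bar>"]) (auto simp: s_def)
          then show "(\<lambda>k. ennreal (weight n z) * ennreal ((cmod (s k n - \<eta> n))\<^sup>2)) \<longlonglongrightarrow> 0"
            by (rule tendsto_eventually)
        qed
      qed simp_all
      then have "(\<lambda>k. wnorm2 r m0 z (\<lambda>n. s k n - \<eta> n)) \<longlonglongrightarrow> 0" by simp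
      moreover have "s k \<in> K" for k unfolding s_def by (rule trunc) simp
      ultimately show "\<eta> \<in> K"
        using closed \<eta> unfolding closed_subspace_z_def by blast
    qed
    moreover have "K \<subseteq> H_z r m0 z" using closed unfolding closed_subspace_z_def by blast
    ultimately show ?thesis by blast
  qed simp
qed

text \<open>If periodic points had positive measure they would have full measure by ergodicity; strong
  invariance then makes almost every fibre a singleton, and the filter condition forces
  \<open>\<bar>m0\<bar> = 1\<close>.\<close>

lemma periodic_sets: "{x. (r ^^ p) x = x} \<in> sets borel"
proof -
  have "{x \<in> space borel. (r ^^ p) x = id x} \<in> sets borel"
    by (rule sets_Collect_eq_compact[OF compact_UNIV]) (simp_all add: id_def)
  then show ?thesis by simp
qed

definition Per :: "'a set" where
  "Per = {x. \<exists>p. (r ^^ Suc p) x = x}"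

lemma Per_sets [measurable]: "Per \<in> sets borel"
proof -
  have "Per = (\<Union>p. {x. (r ^^ Suc p) x = x})" by (auto simp: Per_def)
  also have "\<dots> \<in> sets borel" by (rule sets.countable_UN) (use periodic_sets in blast)
  finally show ?thesis .
qed

lemma r_Per: "x \<in> Per \<Longrightarrow> r x \<in> Per"
  unfolding Per_def by (clarsimp, metis funpow_swap1)

text \<open>A common period \<open>P\<close> of both points recovers each of them from its image by
  applying \<open>r\<close> another \<open>P - 1\<close> times.\<close>

lemma r_inj_on_Per:
  assumes "x \<in> Per" "y \<in> Per" "r x = r y" shows "x = y"
proof -
  obtain p q where p: "(r ^^ Suc p) x = x" and q: "(r ^^ Suc q) y = y"
    using assms by (auto simp: Per_def)
  have x: "(r ^^ (Suc p * k)) x = x" for k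
    using funpow_fixed[of "r ^^ Suc p" x k, OF p] by (simp only: funpow_mult)
  have y: "(r ^^ (Suc q * k)) y = y" for k
    using funpow_fixed[of "r ^^ Suc q" y k, OF q] by (simp only: funpow_mult)
  \<comment> \<open>Chosen so that \<open>Suc N\<close> is the common period
    \<open>Suc p * Suc q\<close>.\<close>
  define N where "N = p + q + p * q"
  have N: "Suc p * Suc q = Suc N" "Suc q * Suc p = Suc N" by (simp_all add: N_def algebra_simps)
  have "x = (r ^^ Suc N) x" using x[of "Suc q"] unfolding N by simp
  also have "\<dots> = (r ^^ N) (r x)" by (simp add: funpow_swap1)
  also have "\<dots> = (r ^^ Suc N) y" unfolding assms(3) by (simp add: funpow_swap1)
  also have "\<dots> = y" using y[of "Suc p"] unfolding N by simp
  finally show ?thesis .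
qed

lemma emeasure_vimage_r: "B \<in> sets borel \<Longrightarrow> emeasure \<mu> (r -` B) = emeasure \<mu> B"
  using emeasure_distr[of r \<mu> \<mu> B] by (simp add: distr_r)

lemma AE_not_Per: "AE x in \<mu>. x \<notin> Per"
proof (rule ccontr)
  assume not: "\<not> (AE x in \<mu>. x \<notin> Per)"
  \<comment> \<open>\<open>Per\<close> is only mapped into itself, whereas ergodicity concerns sets
    equal to their preimage. The preimages increase, all have the measure of \<open>Per\<close>, and
    their union is exactly invariant.\<close>
  define V where "V n = (r ^^ n) -` Per" for n
  have V_Suc: "V (Suc n) = r -` V n" for n
    by (auto simp: V_def funpow_swap1)
  have V_sets [measurable]: "V n \<in> sets borel" for n
    using measurable_sets[OF funpow_measurable[of n] Per_sets] by (simp add: V_def)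
  have V_meas: "emeasure \<mu> (V n) = emeasure \<mu> Per" for n
  proof (induction n)
    case (Suc n)
    then show ?case using emeasure_vimage_r[OF V_sets[of n]] by (simp add: V_Suc)
  qed (simp add: V_def)
  have "(r ^^ n) x \<in> Per \<Longrightarrow> (r ^^ Suc n) x \<in> Per" for n x
    using r_Per by simp
  then have inc: "incseq V" by (intro incseq_SucI) (auto simp: V_def)
  have "r -` (\<Union>n. V n) = (\<Union>n. V n)"
  proof -
    have "r -` (\<Union>n. V n) = (\<Union>n. V (Suc n))" by (auto simp: V_Suc)
    also have "\<dots> = (\<Union>n. V n)"
    proof (rule antisym)
      show "(\<Union>n. V n) \<subseteq> (\<Union>n. V (Suc n))"
        using incseq_SucD[OF inc] by (intro UN_mono) auto
    qed blast
    finally show ?thesis .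
  qed
  then have "emeasure \<mu> (\<Union>n. V n) = 0 \<or> emeasure \<mu> (\<Union>n. V n) = 1"
    using ergodic_r unfolding ergodic_def by simp
  moreover have "emeasure \<mu> (\<Union>n. V n) = emeasure \<mu> Per"
  proof -
    have "(SUP n. emeasure \<mu> (V n)) = emeasure \<mu> (\<Union>n. V n)"
      by (rule SUP_emeasure_incseq[OF _ inc]) auto
    then show ?thesis by (simp add: V_meas)
  qed
  moreover have "emeasure \<mu> Per \<noteq> 0"
  proof
    assume "emeasure \<mu> Per = 0"
    then have "AE x in \<mu>. x \<notin> Per" by (intro AE_not_in null_setsI) simp_all
    with not show False by simp
  qed
  ultimately have "emeasure \<mu> Per = 1" by simp
  then have Per_AE: "AE x in \<mu>. x \<in> Per"
    by (intro AE_prob_1) (simp add: emeasure_eq_measure)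
  \<comment> \<open>Averaging over fibres upgrades the statement about almost every point to one
    about all points of almost every fibre.\<close>
  have "(\<integral>\<^sup>+x. indicator (- Per) x \<partial>\<mu>) = (\<integral>\<^sup>+x. 0 \<partial>\<mu>)"
    by (rule nn_integral_cong_AE) (use Per_AE in eventually_elim, simp)
  then have "(\<integral>\<^sup>+x. fibre_avg (indicator (- Per)) x \<partial>\<mu>) = 0"
    by (subst nn_integral_fibre_avg) simp_all
  then have "AE x in \<mu>. fibre_avg (indicator (- Per)) x = 0"
    by (subst (asm) nn_integral_0_iff_AE) simp_all
  then have "AE x in \<mu>. \<forall>y\<in>r -` {x}. cmod (m0 y) = 1"
    using Per_AE
  proof eventually_elim
    case (elim x)
    have "(\<Sum>y\<in>r -` {x}. indicator (- Per) y :: ennreal) = 0"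
      using elim(1) card_fibre_pos[of x] by (simp add: fibre_avg_def)
    then have Per: "y \<in> Per" if "r y = x" for y
      using that finite_fibre[of x] by (auto simp: indicator_def)
    show ?case
    proof
      fix y assume y: "y \<in> r -` {x}"
      have fib: "r -` {x} = {y}"
      proof (rule antisym; rule subsetI)
        fix y' assume "y' \<in> r -` {x}"
        then show "y' \<in> {y}" using r_inj_on_Per[of y' y] Per y by auto
      qed (use y in simp)
      have "(1 / real (card (r -` {x}))) * (\<Sum>y\<in>r -` {x}. (cmod (m0 y))\<^sup>2) = 1"
        using qmf unfolding qmf_def by blast
      then have "(cmod (m0 y))\<^sup>2 = 1" unfolding fib by simp
      then show "cmod (m0 y) = 1" using power2_eq_imp_eq[of "cmod (m0 y)" 1] by simp
    qed
  qed
  \<comment> \<open>Evaluated at \<open>r x\<close>, because \<open>x\<close> belongs to the fibre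
    of \<open>r x\<close>.\<close>
  then have "AE x in \<mu>. \<forall>y\<in>r -` {r x}. cmod (m0 y) = 1" by (rule AE_comp_r)
  then have "AE x in \<mu>. cmod (m0 x) = 1" by eventually_elim simp
  with m0_not_unimodular show False by simp
qed

text \<open>A repeated value makes a point of the orbit periodic, and periodicity passes to all
  later points, where \<open>AE_not_Per\<close> and invariance of \<mu> exclude it.\<close>

lemma AE_inj: "AE z in M. inj (\<lambda>n. orbit n z)"
proof -
  have "AE z in M. \<forall>n. (r ^^ n) (z 0) \<notin> Per"
    by (rule AE_coord_0) (rule AE_comp_r_funpow[OF AE_not_Per])
  then show ?thesis using AE_good
  proof eventually_elim
    case (elim z)
    have sol: "z \<in> sol r" using elim(2) by (rule good_sol)
    have shift: "orbit (n + int k) z = (r ^^ k) (orbit n z)" for n k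
    proof (induction k)
      case (Suc k)
      then show ?case using orbit_Suc[OF sol, of "n + int k"] by (simp add: algebra_simps)
    qed simp
    have False if eq: "orbit n z = orbit m z" and "n < m" for n m
    proof -
      \<comment> \<open>The repetition may start at a negative time; \<open>k\<close> steps move it
        to a nonnegative one, where the orbit is a forward iterate of \<open>z 0\<close>.\<close>
      define k where "k = nat \<bar>n\<bar>"
      define p where "p = nat (m - n) - 1"
      have m: "m = n + int (Suc p)" using \<open>n < m\<close> by (simp add: p_def)
      have nk: "n + int k = int (nat (n + int k))" by (simp add: k_def)
      have "(r ^^ Suc p) (orbit (n + int k) z) = orbit (n + int k + int (Suc p)) z" by (rule shift[symmetric])
      also have "\<dots> = orbit (m + int k) z" unfolding m by (simp add: algebra_simps)
      also have "\<dots> = (r ^^ k) (orbit m z)" by (rule shift)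
      also have "\<dots> = orbit (n + int k) z" unfolding eq[symmetric] by (rule shift[symmetric])
      finally have "orbit (n + int k) z \<in> Per" unfolding Per_def by blast
      then have "(r ^^ nat (n + int k)) (z 0) \<in> Per" using nk orbit_nonneg[OF sol] by metis
      then show False using elim(1) by blast
    qed
    then show ?case by (intro injI) (metis linorder_neqE)
  qed
qed

lemma AE_irreducible: "AE z in M. irreducible_z r m0 z"
  using AE_inj AE_good by eventually_elim (rule irreducible_if_inj)

end

theorem theorem3p3:
  fixes r :: "'a::metric_space \<Rightarrow> 'a"
    and \<mu> :: "'a measure"
    and m0 :: "'a \<Rightarrow> complex"
  assumes "compact (UNIV :: 'a set)"
    and "surj r"
    and "\<And>x. finite (r -` {x})"
    and "r \<in> borel_measurable borel"
    and "prob_space \<mu>" and "sets \<mu> = sets borel"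
    and "strongly_invariant r \<mu>"
    and "ergodic r \<mu>"
    and "qmf r m0"
    and "\<not> (AE x in \<mu>. cmod (m0 x) = 1)"
    and "emeasure \<mu> {x. m0 x = 0} = 0"
    and "integrable \<mu> (\<lambda>x. ln ((cmod (m0 x))\<^sup>2))"
  shows "\<exists>F \<Psi>. F \<subseteq> sol r \<and> fundamental_domain r (mu_inf r \<mu> m0) F \<and>
           unitary_intertwiner r m0 (mu_inf r \<mu> m0) F \<Psi> \<and>
           (AE z in mu_inf r \<mu> m0. z \<in> F \<longrightarrow> irreducible_z r m0 z)"
proof -
  interpret prob_space \<mu> by fact
  interpret finite_to_one_system \<mu> r
    by standard (use assms in auto)
  interpret qmf_system \<mu> r m0
    by standard (rule assms)
  have "{x. m0 x = 0} \<in> sets \<mu>"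
  proof -
    have "{x \<in> space borel. m0 x = 0} \<in> sets borel" by measurable
    then show ?thesis by simp
  qed
  then have "AE x in \<mu>. x \<notin> {x. m0 x = 0}"
    using assms(11) by (intro AE_not_in null_setsI)
  then have nz: "AE x in \<mu>. m0 x \<noteq> 0" by simp
  have mu_inf: "is_mu_inf r \<mu> m0 (mu_inf r \<mu> m0)"
    unfolding mu_inf_def using ex_mu_inf by (rule someI_ex)
  interpret wavelet_system \<mu> r m0 "mu_inf r \<mu> m0"
    by unfold_locales (fact mu_inf nz assms)+
  have "fund_dom \<subseteq> sol r" using fund_dom_good good_sol by blast
  moreover have "AE z in mu_inf r \<mu> m0. z \<in> fund_dom \<longrightarrow> irreducible_z r m0 z"
    using AE_irreducible by eventually_elim simp
  ultimately show ?thesis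
    using fundamental_domain_fund_dom unitary_intertwiner_Psi by blast
qed

end
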